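(* There is a constant $c = \exp(-O(k))$ and a randomized algorithm running in time $\mathrm{poly}(m,n,\exp(k))$ such that, given an instance $\Im$ of Max-$k$XOR on $n$ variables with $m$ constraints in which every variable has degree at most $D$, the algorithm finds with high probability an assignment $x \in \{\pm1\}^n$ such that \[ \left| \mathrm{val}_{\Im}(x) - \tfrac12 \right| \geq \frac{c}{\sqrt{D}}. \] In particular, for odd $k$, by trying the assignment and its negation, the algorithm can output an $x$ satisfying $\mathrm{val}_{\Im}(x) \geq \tfrac12 + \frac{c}{\sqrt{D}}$.
   Context: Variables $x_1,\dots,x_n$ take values in $\{\pm1\}$. An instance of Max-$k$XOR consists of $m$ constraints; each constraint has a scope $S_\ell$, a set of exactly $k$ distinct indices in $[n]$, and a sign $b_\ell \in \{\pm1\}$, and is satisfied by $x$ iff $b_\ell \prod_{j\in S_\ell} x_j = 1$ (i.e. the predicate is $\tfrac12 + \tfrac12 b_\ell \prod_{j\in S_\ell}x_j$). It is assumed that all scopes are distinct as sets (so no constraint appears twice and no constraint appears together with its negation). The degree of a variable $x_i$ is the number of constraints whose scope contains $i$. $\mathrm{val}_{\Im}(x)$ denotes the fraction of the constraints of $\Im$ satisfied by $x$. *)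

theory Defs
  imports "HOL-Probability.Probability"
begin

section \<open>Max-kXOR\<close>

text \<open>An instance is the list of its constraints, each given by its scope and its sign.\<close>

type_synonym xor_constraint = "nat set \<times> int"

definition satisfied :: "(nat \<Rightarrow> int) \<Rightarrow> xor_constraint \<Rightarrow> bool" where
  "satisfied x C \<longleftrightarrow> snd C * (\<Prod>j\<in>fst C. x j) = 1"

text \<open>Distinctness is required of the scopes as sets, irrespective of the signs.  At least
  one constraint is required, as otherwise the fraction of satisfied constraints is undefined.\<close>

definition max_kxor :: "nat \<Rightarrow> nat \<Rightarrow> xor_constraint list \<Rightarrow> bool" where
  "max_kxor n k I \<longleftrightarrow>
     1 \<le> k \<and> I \<noteq> [] \<and> distinct (map fst I) \<and>
     (\<forall>(S, b)\<in>set I. S \<subseteq> {1..n} \<and> card S = k \<and> b \<in> {1, -1})"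

definition var_degree :: "xor_constraint list \<Rightarrow> nat \<Rightarrow> nat" where
  "var_degree I i = card {l. l < length I \<and> i \<in> fst (I ! l)}"

definition val :: "xor_constraint list \<Rightarrow> (nat \<Rightarrow> int) \<Rightarrow> real" where
  "val I x = real (card {l. l < length I \<and> satisfied x (I ! l)}) / real (length I)"

definition assignment :: "nat \<Rightarrow> (nat \<Rightarrow> int) \<Rightarrow> bool" where
  "assignment n x \<longleftrightarrow> (\<forall>i\<in>{1..n}. x i \<in> {1, -1})"


section \<open>Randomized algorithms\<close>

text \<open>Algorithms are programs for a randomized random-access machine whose memory consists of
  named integer arrays; a scalar is an array used at index 0 only.  Every assignment, coin flip
  and test costs one time unit.  There is no multiplication, so in \<open>t\<close> steps the bit length of
  the stored numbers grows by at most \<open>O(t)\<close>, and unit-cost time is polynomially related to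
  time on a probabilistic Turing machine.\<close>

type_synonym store = "string \<Rightarrow> int \<Rightarrow> int"

datatype aexp = Const int | Get string aexp | Plus aexp aexp | Minus aexp aexp

datatype bexp = Less aexp aexp | Neg bexp | Conj bexp bexp

datatype com =
    Skip
  | Assign string aexp aexp
  | Flip string aexp
  | Seq com com
  | Cond bexp com com
  | While bexp com

primrec aval :: "aexp \<Rightarrow> store \<Rightarrow> int" where
  "aval (Const c) s = c"
| "aval (Get v a) s = s v (aval a s)"
| "aval (Plus a1 a2) s = aval a1 s + aval a2 s"
| "aval (Minus a1 a2) s = aval a1 s - aval a2 s"

primrec bval :: "bexp \<Rightarrow> store \<Rightarrow> bool" where
  "bval (Less a1 a2) s \<longleftrightarrow> aval a1 s < aval a2 s"
| "bval (Neg b) s \<longleftrightarrow> \<not> bval b s"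
| "bval (Conj b1 b2) s \<longleftrightarrow> bval b1 s \<and> bval b2 s"

definition put :: "string \<Rightarrow> int \<Rightarrow> int \<Rightarrow> store \<Rightarrow> store" where
  "put v i c s = s(v := (s v)(i := c))"

text \<open>The semantics yields the joint distribution of the final store and the running time; the
  missing probability mass is the probability of divergence.\<close>

partial_function (spmf) loop ::
  "(store \<Rightarrow> bool) \<Rightarrow> (store \<Rightarrow> (store \<times> nat) spmf) \<Rightarrow> store \<Rightarrow> (store \<times> nat) spmf" where
  "loop b body s =
     (if b s then
        bind_spmf (body s) (\<lambda>(s1, t1).
        bind_spmf (loop b body s1) (\<lambda>(s2, t2).
        return_spmf (s2, 1 + t1 + t2)))
      else return_spmf (s, 1))"

primrec exec :: "com \<Rightarrow> store \<Rightarrow> (store \<times> nat) spmf" where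
  "exec Skip s = return_spmf (s, 1)"
| "exec (Assign v i a) s = return_spmf (put v (aval i s) (aval a s) s, 1)"
| "exec (Flip v i) s =
     map_spmf (\<lambda>h. (put v (aval i s) (if h then 1 else 0) s, 1)) coin_spmf"
| "exec (Seq c1 c2) s =
     bind_spmf (exec c1 s) (\<lambda>(s1, t1).
     bind_spmf (exec c2 s1) (\<lambda>(s2, t2).
     return_spmf (s2, t1 + t2)))"
| "exec (Cond b c1 c2) s =
     map_spmf (\<lambda>(s1, t1). (s1, 1 + t1)) (if bval b s then exec c1 s else exec c2 s)"
| "exec (While b c) s = loop (bval b) (exec c) s"


section \<open>Algorithms for Max-kXOR\<close>

definition array_of :: "int list \<Rightarrow> int \<Rightarrow> int" where
  "array_of xs i = (if 0 \<le> i \<and> i < int (length xs) then xs ! nat i else 0)"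

text \<open>The variables of the scope of constraint \<open>l\<close>, counted from 0, occupy the cells
  \<open>l * k, \<dots>, l * k + k - 1\<close> of the array \<open>scope\<close>, in increasing order.  The degree bound is not
  part of the input.\<close>

definition encode :: "nat \<Rightarrow> nat \<Rightarrow> xor_constraint list \<Rightarrow> store" where
  "encode n k I = (\<lambda>_ _. 0)
     (''n'' := array_of [int n],
      ''m'' := array_of [int (length I)],
      ''k'' := array_of [int k],
      ''scope'' := array_of (map int (concat (map (\<lambda>C. sorted_list_of_set (fst C)) I))),
      ''sign'' := array_of (map snd I))"

definition output_of :: "store \<Rightarrow> nat \<Rightarrow> int" where
  "output_of s i = s ''x'' (int i)"

text \<open>The program halts on every instance, and the time bound holds for every outcome of the
  coin flips.\<close>

definition poly_time :: "com \<Rightarrow> bool" where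
  "poly_time P \<longleftrightarrow> (\<exists>K d. \<forall>n k I. max_kxor n k I \<longrightarrow>
     lossless_spmf (exec P (encode n k I)) \<and>
     (\<forall>(s, t)\<in>set_spmf (exec P (encode n k I)).
        real t \<le> K * (real (length I) + real n + exp (real k)) ^ d))"

definition prob_finds ::
  "com \<Rightarrow> nat \<Rightarrow> nat \<Rightarrow> xor_constraint list \<Rightarrow> ((nat \<Rightarrow> int) \<Rightarrow> bool) \<Rightarrow> real" where
  "prob_finds P n k I Q =
     measure (measure_spmf (exec P (encode n k I)))
       {(s, t). assignment n (output_of s) \<and> Q (output_of s)}"

end

theory Submission
  imports Defs
begin

text \<open>For uniform signs \<open>y\<close> let \<open>H j\<close> be the sum of the signed monomials of the constraints
  containing \<open>j\<close>. It is a polynomial of degree at most \<open>k\<close> and second moment \<open>deg j\<close>, so by the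
  Bonami lemma \<open>E \<bar>H j\<bar> \<ge> sqrt (deg j) / 3 ^ (k + 1)\<close>, and the sum over all \<open>j\<close> is of order
  \<open>exp (- O(k)) * m / sqrt D\<close>.  Negate each \<open>y j\<close> with \<open>H j < 0\<close> independently with probability
  \<open>r\<close>. Given \<open>y\<close>, the expected bias (satisfied minus violated constraints) is a polynomial
  \<open>q r\<close> of degree at most \<open>k\<close> with \<open>k * q 0 + q' 0 = (\<Sum>j. \<bar>H j\<bar>)\<close>. A finite difference formula
  bounds \<open>q' 0\<close> by \<open>exp (O(k))\<close> times the sum of \<open>\<bar>q (i / 2 ^ k)\<bar>\<close> over \<open>i \<le> k\<close>; hence for a uniform
  rate \<open>r = i / 2 ^ k\<close> with \<open>i < 2 ^ k\<close> the expected absolute bias is at least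
  \<open>exp (- O(k)) * m / sqrt D\<close>.  As the absolute bias is at most \<open>m\<close>, one trial succeeds with
  probability \<open>exp (- O(k)) / sqrt D\<close>, and polynomially many independent trials suffice.
  Negating all variables negates the bias when \<open>k\<close> is odd.\<close>

section \<open>Averages over the discrete cube\<close>

text \<open>Negating every variable with negative \<open>H j\<close> at once (rate 1) is not
  controlled: monomials with several negated variables have higher-order effects that may cancel the
  gain, while the sum of the \<bar>H j\<bar> only describes rate 0 to first order. Since the
  expected bias is a polynomial of degree at most \<open>k\<close> in the rate, a large value of
  \<open>k * q 0 + q' 0\<close> forces a large absolute value at one of \<open>k + 1\<close> fixed
  rates, but neither which rate nor the sign is known. Hence the rate is guessed, and only the
  absolute bias is bounded. Nothing in a trial refers to \<open>D\<close>; it enters the analysis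
  through \<open>sqrt d >= d / sqrt D\<close> for a degree \<open>d\<close> between 1 and
  \<open>D\<close>. Rates with denominator \<open>2 ^ k\<close> are those that \<open>k\<close> fair
  coins realise by one comparison, and \<open>k < 2 ^ k\<close> makes room for all
  \<open>k + 1\<close> nodes. The base 24 of the constant is 3 * 4 * 2: \<open>3 ^ k\<close> from
  the Bonami lemma, \<open>4 ^ k\<close> from the finite difference formula (\<open>2 ^ k\<close>
  for binomial coefficients, \<open>2 ^ k\<close> for the spacing of the nodes), and
  \<open>2 ^ k\<close> from guessing the rate.\<close>

primrec avg :: "nat \<Rightarrow> (bool list \<Rightarrow> real) \<Rightarrow> real" where
  "avg 0 f = f []"
| "avg (Suc n) f = (avg n (\<lambda>xs. f (True # xs)) + avg n (\<lambda>xs. f (False # xs))) / 2"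

lemma avg_cong:
  "(\<And>xs. length xs = n \<Longrightarrow> f xs = g xs) \<Longrightarrow> avg n f = avg n g"
proof (induction n arbitrary: f g)
  case (Suc n)
  have "avg n (\<lambda>xs. f (b # xs)) = avg n (\<lambda>xs. g (b # xs))" for b
    by (rule Suc.IH) (simp add: Suc.prems)
  then show ?case by simp
qed simp

lemma avg_mono:
  "(\<And>xs. length xs = n \<Longrightarrow> f xs \<le> g xs) \<Longrightarrow> avg n f \<le> avg n g"
proof (induction n arbitrary: f g)
  case (Suc n)
  have "avg n (\<lambda>xs. f (b # xs)) \<le> avg n (\<lambda>xs. g (b # xs))" for b
    using Suc by simp
  from this[of True] this[of False] show ?case by simp
qed simp

lemma avg_const [simp]: "avg n (\<lambda>_. c) = c"
  by (induction n) auto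

lemma avg_add: "avg n (\<lambda>xs. f xs + g xs) = avg n f + avg n g"
  by (induction n arbitrary: f g) (auto simp: field_simps)

lemma avg_cmult: "avg n (\<lambda>xs. c * f xs) = c * avg n f"
  by (induction n arbitrary: f) (auto simp: field_simps)

lemma avg_mult_right: "avg n (\<lambda>xs. f xs * c) = avg n f * c"
  using avg_cmult[of n c f] by (simp add: mult.commute)

lemma avg_diff: "avg n (\<lambda>xs. f xs - g xs) = avg n f - avg n g"
  using avg_add[of n f "\<lambda>xs. - 1 * g xs"] avg_cmult[of n "- 1" g] by simp

lemma avg_sum: "finite A \<Longrightarrow> avg n (\<lambda>xs. \<Sum>a\<in>A. f a xs) = (\<Sum>a\<in>A. avg n (f a))"
  by (induction A rule: finite_induct) (auto simp: avg_add)

lemma avg_nonneg: "(\<And>xs. length xs = n \<Longrightarrow> 0 \<le> f xs) \<Longrightarrow> 0 \<le> avg n f"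
  using avg_mono[of n "\<lambda>_. 0" f] by simp

lemma abs_avg_le: "\<bar>avg n f\<bar> \<le> avg n (\<lambda>xs. \<bar>f xs\<bar>)"
proof (induction n arbitrary: f)
  case (Suc n)
  show ?case
    using Suc[of "\<lambda>xs. f (True # xs)"] Suc[of "\<lambda>xs. f (False # xs)"] by simp
qed simp

text \<open>Fubini for two blocks of bits. The independence arguments about trials and variables
  rest on it, since independent choices read disjoint segments of the bit list.\<close>

lemma avg_append: "avg (m + n) f = avg m (\<lambda>xs. avg n (\<lambda>ys. f (xs @ ys)))"
  by (induction m arbitrary: f) auto

lemma avg_snoc:
  "avg (Suc n) f = (avg n (\<lambda>xs. f (xs @ [True])) + avg n (\<lambda>xs. f (xs @ [False]))) / 2"
  using avg_append[of n 1 f] avg_cmult[of n "1/2"]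
  by (simp add: avg_add[symmetric] field_simps)

text \<open>The cross term \<open>2 * p * q\<close> is at most
  \<open>2 * sqrt (a * d) * sqrt (b * c)\<close>, which AM-GM bounds by
  \<open>a * d + b * c\<close>. This joins the two halves of the cube in the induction for
  Cauchy-Schwarz.\<close>

lemma square_sum_le:
  fixes p q a b c d :: real
  assumes "p\<^sup>2 \<le> a * c" "q\<^sup>2 \<le> b * d" and nn: "0 \<le> a" "0 \<le> b" "0 \<le> c" "0 \<le> d"
  shows "(p + q)\<^sup>2 \<le> (a + b) * (c + d)"
proof -
  have "\<bar>p * q\<bar> \<le> sqrt (a * d) * sqrt (b * c)"
  proof -
    have "(p * q)\<^sup>2 \<le> (a * c) * (b * d)"
      unfolding power_mult_distrib by (rule mult_mono) (use assms in auto)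
    then have "\<bar>p * q\<bar> \<le> sqrt ((a * d) * (b * c))"
      by (intro real_le_rsqrt) (simp add: algebra_simps)
    then show ?thesis by (simp add: real_sqrt_mult)
  qed
  moreover have "2 * (sqrt (a * d) * sqrt (b * c)) \<le> a * d + b * c"
    using sum_squares_bound[of "sqrt (a * d)" "sqrt (b * c)"] nn by (simp add: mult.assoc)
  ultimately have "2 * (p * q) \<le> a * d + b * c" by linarith
  then show ?thesis using assms(1,2) by (simp add: power2_sum algebra_simps)
qed

lemma avg_Cauchy_Schwarz:
  "(avg n (\<lambda>xs. f xs * g xs))\<^sup>2 \<le> avg n (\<lambda>xs. (f xs)\<^sup>2) * avg n (\<lambda>xs. (g xs)\<^sup>2)"
proof (induction n arbitrary: f g)
  case (Suc n)
  have "(avg n (\<lambda>xs. f (True # xs) * g (True # xs)) + avg n (\<lambda>xs. f (False # xs) * g (False # xs)))\<^sup>2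
    \<le> (avg n (\<lambda>xs. (f (True # xs))\<^sup>2) + avg n (\<lambda>xs. (f (False # xs))\<^sup>2)) *
      (avg n (\<lambda>xs. (g (True # xs))\<^sup>2) + avg n (\<lambda>xs. (g (False # xs))\<^sup>2))"
    by (intro square_sum_le Suc.IH avg_nonneg) auto
  then show ?case by (simp add: power_divide)
qed (simp add: power_mult_distrib)

section \<open>Multilinear polynomials of low degree and the Bonami lemma\<close>

definition sg :: "bool \<Rightarrow> int" where
  "sg b = (if b then 1 else -1)"

lemma sg_cases: "sg b = 1 \<or> sg b = -1"
  by (simp add: sg_def)

text \<open>\<open>lowdeg n d f\<close>: on lists of \<open>n\<close> bits, \<open>f\<close> is a multilinear polynomial of degree at most \<open>d\<close>
  in the signs. The recursion splits off the last variable, as the induction for the Bonami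
  lemma does.\<close>

primrec lowdeg :: "nat \<Rightarrow> nat \<Rightarrow> (bool list \<Rightarrow> real) \<Rightarrow> bool" where
  "lowdeg 0 d f \<longleftrightarrow> True"
| "lowdeg (Suc n) d f \<longleftrightarrow>
     (\<exists>g h. (\<forall>xs b. length xs = n \<longrightarrow> f (xs @ [b]) = g xs + of_int (sg b) * h xs) \<and>
        lowdeg n d g \<and> (if d = 0 then h = (\<lambda>_. 0) else lowdeg n (d - 1) h))"

lemma lowdeg_SucI:
  assumes "\<And>xs b. length xs = n \<Longrightarrow> f (xs @ [b]) = g xs + of_int (sg b) * h xs"
    and "lowdeg n d g" "d = 0 \<Longrightarrow> h = (\<lambda>_. 0)" "d \<noteq> 0 \<Longrightarrow> lowdeg n (d - 1) h"
  shows "lowdeg (Suc n) d f"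
  unfolding lowdeg.simps
  by (rule exI[of _ g], rule exI[of _ h]) (use assms in auto)

lemma lowdeg_const: "lowdeg n d (\<lambda>_. c)"
proof (induction n arbitrary: d c)
  case (Suc n)
  show ?case by (rule lowdeg_SucI[where g = "\<lambda>_. c" and h = "\<lambda>_. 0"]) (auto intro: Suc)
qed simp

lemma lowdeg_add: "lowdeg n d f \<Longrightarrow> lowdeg n d f' \<Longrightarrow> lowdeg n d (\<lambda>xs. f xs + f' xs)"
proof (induction n arbitrary: d f f')
  case (Suc n)
  obtain g h where f: "\<And>xs b. length xs = n \<Longrightarrow> f (xs @ [b]) = g xs + of_int (sg b) * h xs"
    "lowdeg n d g" "if d = 0 then h = (\<lambda>_. 0) else lowdeg n (d - 1) h"
    using Suc.prems(1) by auto
  obtain g' h' where f': "\<And>xs b. length xs = n \<Longrightarrow> f' (xs @ [b]) = g' xs + of_int (sg b) * h' xs"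
    "lowdeg n d g'" "if d = 0 then h' = (\<lambda>_. 0) else lowdeg n (d - 1) h'"
    using Suc.prems(2) by auto
  show ?case
    by (rule lowdeg_SucI[where g = "\<lambda>xs. g xs + g' xs" and h = "\<lambda>xs. h xs + h' xs"])
      (use f f' in \<open>auto simp: algebra_simps intro: Suc.IH split: if_splits\<close>)
qed simp

lemma lowdeg_sum:
  "finite A \<Longrightarrow> (\<And>a. a \<in> A \<Longrightarrow> lowdeg n d (f a)) \<Longrightarrow> lowdeg n d (\<lambda>xs. \<Sum>a\<in>A. f a xs)"
  by (induction A rule: finite_induct) (auto intro: lowdeg_add lowdeg_const)

text \<open>The character of \<open>S\<close>. Variables are numbered from 1 and list positions from
  0, hence the index \<open>j - 1\<close>.\<close>

definition chi :: "nat set \<Rightarrow> bool list \<Rightarrow> real" where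
  "chi S xs = (\<Prod>j\<in>S. of_int (sg (xs ! (j - 1))))"

lemma chi_snoc:
  assumes "S \<subseteq> {1..Suc n}" "length xs = n"
  shows "chi S (xs @ [b]) =
    (if Suc n \<in> S then of_int (sg b) * chi (S - {Suc n}) xs else chi S xs)"
proof -
  have eq: "chi U (xs @ [b]) = chi U xs" if "U \<subseteq> {1..n}" for U
    unfolding chi_def
  proof (rule prod.cong)
    fix j assume "j \<in> U"
    then have "j \<in> {1..n}" using that by blast
    then have "j - 1 < length xs" using assms(2) by auto
    then show "real_of_int (sg ((xs @ [b]) ! (j - 1))) = real_of_int (sg (xs ! (j - 1)))"
      by (simp add: nth_append)
  qed simp
  have fin: "finite S" using assms(1) finite_subset by blast
  show ?thesis
  proof (cases "Suc n \<in> S")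
    case True
    have "chi S (xs @ [b]) = of_int (sg b) * chi (S - {Suc n}) (xs @ [b])"
      unfolding chi_def by (subst prod.remove[OF fin True]) (simp add: nth_append assms(2))
    moreover have "S - {Suc n} \<subseteq> {1..n}" using assms(1) by (auto simp: le_Suc_eq)
    ultimately show ?thesis using True eq by simp
  next
    case False
    then have "S \<subseteq> {1..n}" using assms(1) by (auto simp: le_Suc_eq subset_iff)
    then show ?thesis using False eq by simp
  qed
qed

lemma lowdeg_chi: "S \<subseteq> {1..n} \<Longrightarrow> card S \<le> d \<Longrightarrow> lowdeg n d (\<lambda>xs. c * chi S xs)"
proof (induction n arbitrary: S d)
  case (Suc n)
  have fin: "finite S" using Suc.prems(1) finite_subset by blast
  show ?case
  proof (cases "Suc n \<in> S")
    case True
    then have c: "card (S - {Suc n}) = card S - 1" "card S \<noteq> 0" using fin by auto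
    have "S - {Suc n} \<subseteq> {1..n}" using Suc.prems(1) by (auto simp: le_Suc_eq)
    then have "lowdeg n (d - 1) (\<lambda>xs. c * chi (S - {Suc n}) xs)"
      using Suc.IH Suc.prems c by simp
    then show ?thesis
      by (intro lowdeg_SucI[where g = "\<lambda>_. 0" and h = "\<lambda>xs. c * chi (S - {Suc n}) xs"])
        (use c Suc.prems True in \<open>auto simp: chi_snoc lowdeg_const\<close>)
  next
    case False
    then have "S \<subseteq> {1..n}" using Suc.prems(1) by (auto simp: le_Suc_eq subset_iff)
    then show ?thesis
      by (intro lowdeg_SucI[where g = "\<lambda>xs. c * chi S xs" and h = "\<lambda>_. 0"])
        (use False Suc in \<open>auto simp: chi_snoc lowdeg_const\<close>)
  qed
qed simp

text \<open>Write \<open>f = g + y * h\<close> with \<open>y\<close> the last sign. Odd powers of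
  \<open>y\<close> average out, so the second moment is \<open>a + b\<close> and the fourth is that
  of \<open>g\<close>, plus that of \<open>h\<close>, plus six times the mixed term
  \<open>x\<close>. Cauchy-Schwarz bounds \<open>x\<close> by the two fourth moments. Because
  \<open>h\<close> has degree one less, its bound carries \<open>9 ^ (d - 1)\<close>, and
  \<open>6 * 3 * 9 ^ (d - 1) = 2 * 9 ^ d\<close> is just the coefficient of \<open>a * b\<close> in
  \<open>9 ^ d * (a + b)\<^sup>2\<close>.\<close>

lemma Bonami_fourth_moment:
  "lowdeg n d f \<Longrightarrow> avg n (\<lambda>xs. f xs ^ 4) \<le> 9 ^ d * (avg n (\<lambda>xs. (f xs)\<^sup>2))\<^sup>2"
proof (induction n arbitrary: d f)
  case 0
  have "(1::real) \<le> 9 ^ d" by simp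
  from mult_right_mono[OF this, of "f [] ^ 4"] show ?case by simp
next
  case (Suc n)
  obtain g h where f: "\<And>xs b. length xs = n \<Longrightarrow> f (xs @ [b]) = g xs + of_int (sg b) * h xs"
    and g: "lowdeg n d g" and h: "if d = 0 then h = (\<lambda>_. 0) else lowdeg n (d - 1) h"
    using Suc.prems by auto
  define a where "a = avg n (\<lambda>xs. (g xs)\<^sup>2)"
  define b where "b = avg n (\<lambda>xs. (h xs)\<^sup>2)"
  have a0: "0 \<le> a" and b0: "0 \<le> b" unfolding a_def b_def by (auto intro: avg_nonneg)
  have "avg (Suc n) (\<lambda>xs. (f xs)\<^sup>2) =
      (avg n (\<lambda>xs. (g xs + h xs)\<^sup>2) + avg n (\<lambda>xs. (g xs - h xs)\<^sup>2)) / 2"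
    unfolding avg_snoc by (simp add: f sg_def cong: avg_cong)
  also have "\<dots> = avg n (\<lambda>xs. (g xs)\<^sup>2 + (h xs)\<^sup>2)"
    unfolding avg_add[symmetric] using avg_cmult[of n 2 "\<lambda>xs. (g xs)\<^sup>2 + (h xs)\<^sup>2"]
    by (simp add: power2_eq_square algebra_simps)
  finally have sq: "avg (Suc n) (\<lambda>xs. (f xs)\<^sup>2) = a + b" by (simp add: avg_add a_def b_def)
  define x where "x = avg n (\<lambda>xs. (g xs)\<^sup>2 * (h xs)\<^sup>2)"
  have "avg (Suc n) (\<lambda>xs. (f xs) ^ 4) =
      (avg n (\<lambda>xs. (g xs + h xs) ^ 4) + avg n (\<lambda>xs. (g xs - h xs) ^ 4)) / 2"
    unfolding avg_snoc by (simp add: f sg_def cong: avg_cong)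
  also have "\<dots> = avg n (\<lambda>xs. g xs ^ 4 + 6 * ((g xs)\<^sup>2 * (h xs)\<^sup>2) + h xs ^ 4)"
    unfolding avg_add[symmetric]
    using avg_cmult[of n 2 "\<lambda>xs. g xs ^ 4 + 6 * ((g xs)\<^sup>2 * (h xs)\<^sup>2) + h xs ^ 4"]
    by (simp add: power2_eq_square power4_eq_xxxx algebra_simps)
  finally have fourth: "avg (Suc n) (\<lambda>xs. f xs ^ 4) =
      avg n (\<lambda>xs. g xs ^ 4) + 6 * x + avg n (\<lambda>xs. h xs ^ 4)"
    by (simp add: avg_add avg_cmult x_def)
  have g4: "avg n (\<lambda>xs. g xs ^ 4) \<le> 9 ^ d * a\<^sup>2"
    using Suc.IH[OF g] by (simp add: a_def)
  show ?case
  proof (cases d)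
    case 0
    then have "h = (\<lambda>_. 0)" using h by simp
    then show ?thesis using g4 sq fourth by (simp add: b_def x_def)
  next
    case (Suc e)
    have h4: "avg n (\<lambda>xs. h xs ^ 4) \<le> 9 ^ e * b\<^sup>2"
      using Suc.IH[of e h] h Suc by (simp add: b_def)
    have "x\<^sup>2 \<le> avg n (\<lambda>xs. g xs ^ 4) * avg n (\<lambda>xs. h xs ^ 4)"
      unfolding x_def using avg_Cauchy_Schwarz[of n "\<lambda>xs. (g xs)\<^sup>2" "\<lambda>xs. (h xs)\<^sup>2"] by simp
    also have "\<dots> \<le> (9 ^ d * a\<^sup>2) * (9 ^ e * b\<^sup>2)"
      by (rule mult_mono[OF g4 h4]) (auto intro: avg_nonneg)
    also have "\<dots> = (3 * 9 ^ e * a * b)\<^sup>2"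
      by (simp add: Suc power2_eq_square)
    finally have "x \<le> 3 * 9 ^ e * a * b"
      by (rule power2_le_imp_le) (use a0 b0 in simp)
    then have "avg (Suc n) (\<lambda>xs. f xs ^ 4) \<le> 9 ^ d * a\<^sup>2 + 18 * 9 ^ e * a * b + 9 ^ e * b\<^sup>2"
      using g4 h4 fourth by linarith
    also have "\<dots> \<le> 9 ^ d * a\<^sup>2 + 18 * 9 ^ e * a * b + 9 ^ d * b\<^sup>2"
      by (simp add: Suc mult_right_mono)
    also have "\<dots> = 9 ^ d * (a + b)\<^sup>2" by (simp add: Suc power2_eq_square algebra_simps)
    finally show ?thesis unfolding sq .
  qed
qed

section \<open>Orthogonality of characters and the comparison of first and second moments\<close>

lemma avg_chi: "S \<subseteq> {1..n} \<Longrightarrow> avg n (chi S) = (if S = {} then 1 else 0)"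
proof (induction n arbitrary: S)
  case 0
  then show ?case by (simp add: chi_def)
next
  case (Suc n)
  show ?case
  proof (cases "Suc n \<in> S")
    case True
    have "avg (Suc n) (chi S) = 0"
      unfolding avg_snoc using avg_cmult[of n "-1" "chi (S - {Suc n})"]
      by (simp add: chi_snoc[OF Suc.prems] True sg_def cong: avg_cong)
    then show ?thesis using True by auto
  next
    case False
    then have "S \<subseteq> {1..n}" using Suc.prems by (auto simp: le_Suc_eq subset_iff)
    then show ?thesis using Suc.IH unfolding avg_snoc
      by (simp add: chi_snoc[OF Suc.prems] False cong: avg_cong)
  qed
qed

text \<open>Signs square to 1, so the factors of the common part cancel and the symmetric difference
  remains.\<close>

lemma chi_mult:
  assumes "finite S" "finite U"
  shows "chi S xs * chi U xs = chi ((S - U) \<union> (U - S)) xs"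
proof -
  have sq: "chi V xs * chi V xs = 1" for V
    unfolding chi_def prod.distrib[symmetric] by (rule prod.neutral) (auto simp: sg_def)
  have S: "chi S xs = chi (S - U) xs * chi (S \<inter> U) xs"
    unfolding chi_def
    by (subst prod.union_disjoint[symmetric]) (use assms in \<open>auto intro!: prod.cong\<close>)
  have U: "chi U xs = chi (U - S) xs * chi (S \<inter> U) xs"
    unfolding chi_def
    by (subst prod.union_disjoint[symmetric]) (use assms in \<open>auto intro!: prod.cong\<close>)
  have "chi ((S - U) \<union> (U - S)) xs = chi (S - U) xs * chi (U - S) xs"
    unfolding chi_def using assms by (subst prod.union_disjoint) auto
  then show ?thesis using sq[of "S \<inter> U"] unfolding S U by (simp add: algebra_simps)
qed

text \<open>Parseval: distinct sets have a nonempty symmetric difference, so all mixed terms average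
  to 0. The injectivity of \<open>S\<close> is where the distinctness of the scopes enters; equal
  scopes with opposite signs would cancel.\<close>

lemma avg_square_chi_sum:
  assumes A: "finite A" "inj_on S A" "\<And>l. l \<in> A \<Longrightarrow> S l \<subseteq> {1..n}"
    and c: "\<And>l. l \<in> A \<Longrightarrow> (c l)\<^sup>2 = (1::real)"
  shows "avg n (\<lambda>xs. (\<Sum>l\<in>A. c l * chi (S l) xs)\<^sup>2) = real (card A)"
proof -
  have fin: "finite (S l)" if "l \<in> A" for l using A(3)[OF that] finite_subset by blast
  have orth: "avg n (\<lambda>xs. chi (S l) xs * chi (S l') xs) = (if l' = l then 1 else 0)"
    if "l \<in> A" "l' \<in> A" for l l'
  proof -
    have "avg n (\<lambda>xs. chi (S l) xs * chi (S l') xs) = avg n (chi ((S l - S l') \<union> (S l' - S l)))"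
      using that by (intro avg_cong) (simp add: chi_mult fin)
    also have "\<dots> = (if (S l - S l') \<union> (S l' - S l) = {} then 1 else 0)"
      by (rule avg_chi) (use A(3) that in auto)
    also have "(S l - S l') \<union> (S l' - S l) = {} \<longleftrightarrow> l' = l"
      using A(2) that by (auto simp: inj_on_def)
    finally show ?thesis .
  qed
  have "avg n (\<lambda>xs. (\<Sum>l\<in>A. c l * chi (S l) xs)\<^sup>2) =
     avg n (\<lambda>xs. \<Sum>l\<in>A. \<Sum>l'\<in>A. (c l * c l') * (chi (S l) xs * chi (S l') xs))"
    by (simp add: power2_eq_square sum_product algebra_simps)
  also have "\<dots> = (\<Sum>l\<in>A. \<Sum>l'\<in>A. (c l * c l') * avg n (\<lambda>xs. chi (S l) xs * chi (S l') xs))"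
    by (simp add: avg_sum A(1) avg_cmult)
  also have "\<dots> = (\<Sum>l\<in>A. \<Sum>l'\<in>A. if l' = l then 1 else 0)"
    by (intro sum.cong refl) (auto simp: orth c power2_eq_square[symmetric])
  also have "\<dots> = real (card A)" using A(1) by (simp add: sum.delta')
  finally show ?thesis .
qed

text \<open>A fourth moment of at most \<open>9 ^ d * v\<^sup>2\<close> prevents the second moment
  from sitting on rare large values, so the first moment must be comparable to
  \<open>sqrt v\<close>.\<close>

lemma sqrt_second_moment_le:
  assumes "lowdeg n d f" and v: "avg n (\<lambda>xs. (f xs)\<^sup>2) = v" "0 < v"
  shows "sqrt v \<le> 3 * 3 ^ d * avg n (\<lambda>xs. \<bar>f xs\<bar>)"
proof -
  \<comment> \<open>For every \<open>s > 0\<close>, \<open>s\<^sup>2 * z\<^sup>2 - z ^ 4 \<le> s ^ 3 * \<bar>z\<bar>\<close>; this choice of \<open>s\<close> balances the moments.\<close>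
  define s where "s = sqrt (2 * 9 ^ d * v)"
  have s: "0 < s" "s\<^sup>2 = 2 * 9 ^ d * v" using v(2) by (auto simp: s_def)
  have pw: "s\<^sup>2 * z\<^sup>2 - z ^ 4 \<le> s ^ 3 * \<bar>z\<bar>" for z
  proof (cases "\<bar>z\<bar> \<le> s")
    case True
    have "s\<^sup>2 * (\<bar>z\<bar> * \<bar>z\<bar>) \<le> s\<^sup>2 * (s * \<bar>z\<bar>)"
      using True by (intro mult_left_mono mult_right_mono) auto
    moreover have "0 \<le> z ^ 4" by simp
    moreover have "\<bar>z\<bar> * \<bar>z\<bar> = z\<^sup>2" by (simp add: power2_eq_square)
    moreover have "s\<^sup>2 * (s * \<bar>z\<bar>) = s ^ 3 * \<bar>z\<bar>" by (simp add: power2_eq_square power3_eq_cube)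
    ultimately have "s\<^sup>2 * z\<^sup>2 \<le> s ^ 3 * \<bar>z\<bar>" by simp
    then show ?thesis using \<open>0 \<le> z ^ 4\<close> by linarith
  next
    case False
    then have "s\<^sup>2 \<le> z\<^sup>2" using s(1) abs_le_square_iff[of s z] by simp
    then have "s\<^sup>2 * z\<^sup>2 \<le> z\<^sup>2 * z\<^sup>2" by (rule mult_right_mono) simp
    moreover have "0 \<le> s ^ 3 * \<bar>z\<bar>" using s(1) by simp
    moreover have "z ^ 4 = z\<^sup>2 * z\<^sup>2" by (simp add: power2_eq_square power4_eq_xxxx)
    ultimately show ?thesis by linarith
  qed
  have "s\<^sup>2 * v - 9 ^ d * v\<^sup>2 \<le> avg n (\<lambda>xs. s\<^sup>2 * (f xs)\<^sup>2 - f xs ^ 4)"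
    using Bonami_fourth_moment[OF assms(1)] v(1) by (simp add: avg_diff avg_cmult)
  also have "\<dots> \<le> avg n (\<lambda>xs. s ^ 3 * \<bar>f xs\<bar>)" by (rule avg_mono) (rule pw)
  finally have "s\<^sup>2 * v - 9 ^ d * v\<^sup>2 \<le> s ^ 3 * avg n (\<lambda>xs. \<bar>f xs\<bar>)" by (simp add: avg_cmult)
  moreover have "9 ^ d * v\<^sup>2 = s\<^sup>2 * v / 2"
    unfolding s(2) by (simp add: power2_eq_square)
  moreover have "s ^ 3 * avg n (\<lambda>xs. \<bar>f xs\<bar>) = s\<^sup>2 * (s * avg n (\<lambda>xs. \<bar>f xs\<bar>))"
    by (simp add: power2_eq_square power3_eq_cube)
  ultimately have "s\<^sup>2 * v \<le> 2 * (s\<^sup>2 * (s * avg n (\<lambda>xs. \<bar>f xs\<bar>)))" by linarith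
  then have "v \<le> 2 * s * avg n (\<lambda>xs. \<bar>f xs\<bar>)"
    using s(1) by (simp add: mult.left_commute mult.assoc)
  also have "s = sqrt 2 * 3 ^ d * sqrt v"
  proof -
    have "sqrt (9 ^ d) = (3::real) ^ d"
      by (rule real_sqrt_unique) (auto simp: power_mult[symmetric] mult.commute[of d 2] power_mult)
    then show ?thesis by (simp add: s_def real_sqrt_mult)
  qed
  finally have "sqrt v * sqrt v \<le> sqrt v * (2 * sqrt 2 * (3 ^ d * avg n (\<lambda>xs. \<bar>f xs\<bar>)))"
    using v(2) by (simp add: algebra_simps)
  then have "sqrt v \<le> 2 * sqrt 2 * (3 ^ d * avg n (\<lambda>xs. \<bar>f xs\<bar>))"
    by (rule mult_left_le_imp_le) (use v(2) in simp)
  \<comment> \<open>The factor 3 of the statement is \<open>2 * sqrt 2\<close> rounded up, where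
    \<open>sqrt 2\<close> comes from \<open>s = sqrt 2 * 3 ^ d * sqrt v\<close>.\<close>
  also have "\<dots> \<le> 3 * (3 ^ d * avg n (\<lambda>xs. \<bar>f xs\<bar>))"
  proof (rule mult_right_mono)
    show "2 * sqrt 2 \<le> (3::real)"
      using real_le_lsqrt[of "3/2" "2"] by (simp add: power2_eq_square)
    show "0 \<le> 3 ^ d * avg n (\<lambda>xs. \<bar>f xs\<bar>)" by (simp add: avg_nonneg)
  qed
  finally show ?thesis by (simp add: mult.assoc)
qed

section \<open>The expected bias of a trial\<close>

text \<open>The \<open>k\<close>-th finite difference lowers the degree \<open>k\<close> times and
  so kills every polynomial of degree below \<open>k\<close>. In the induction, \<open>r\<close> is
  split as \<open>a + x * h\<close>: the constant part gives an alternating row sum, and absorbing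
  the factor \<open>i\<close> into the binomial coefficient leaves the case \<open>k\<close> for
  \<open>h\<close> shifted by one.\<close>

lemma binomial_alternating_poly:
  fixes r :: "real poly"
  shows "degree r < k \<Longrightarrow> (\<Sum>i\<le>k. (-1) ^ i * of_nat (k choose i) * poly r (of_nat i)) = 0"
proof (induction k arbitrary: r)
  case (Suc k)
  obtain a h where r: "r = pCons a h" by (cases r)
  define h' where "h' = pcompose h [:1, 1:]"
  have ph: "poly h' x = poly h (1 + x)" for x by (simp add: h'_def poly_pcompose)
  have h0: "(\<Sum>i\<le>k. (-1) ^ i * of_nat (k choose i) * poly h' (of_nat i)) = 0"
  proof (cases "h = 0")
    case False
    then have "degree h < k" using Suc.prems by (simp add: r)
    moreover have "degree h' = degree h" by (simp add: h'_def degree_pcompose)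
    ultimately show ?thesis by (intro Suc.IH) simp
  qed (simp add: h'_def)
  have step: "of_nat (Suc k choose Suc i) * (of_nat (Suc i) * z) = of_nat (Suc k) * (of_nat (k choose i) * (z::real))" for i z
    unfolding mult.assoc[symmetric] of_nat_mult[symmetric] by (simp only: Suc_times_binomial[symmetric] mult.commute)
  have "(\<Sum>i\<le>Suc k. (-1) ^ i * of_nat (Suc k choose i) * poly r (of_nat i)) =
      a * (\<Sum>i\<le>Suc k. (-1) ^ i * of_nat (Suc k choose i)) +
      (\<Sum>i\<le>Suc k. (-1) ^ i * of_nat (Suc k choose i) * (of_nat i * poly h (of_nat i)))"
    by (simp only: r poly_pCons ring_distribs sum.distrib sum_distrib_left ac_simps)
  also have "(\<Sum>i\<le>Suc k. (-1) ^ i * of_nat (Suc k choose i) :: real) = 0"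
    by (rule choose_alternating_sum) simp
  also have "(\<Sum>i\<le>Suc k. (-1) ^ i * of_nat (Suc k choose i) * (of_nat i * poly h (of_nat i))) =
      (\<Sum>i\<le>k. (-1) ^ Suc i * (of_nat (Suc k choose Suc i) * (of_nat (Suc i) * poly h' (of_nat i))))"
    by (subst sum.atMost_Suc_shift) (simp add: ph mult.assoc)
  also have "\<dots> = - of_nat (Suc k) * (\<Sum>i\<le>k. (-1) ^ i * of_nat (k choose i) * poly h' (of_nat i))"
    unfolding step sum_distrib_left by (rule sum.cong) (simp_all add: algebra_simps)
  finally show ?case by (simp add: h0)
qed simp

lemma choose_le_pow2: "n choose i \<le> 2 ^ n"
proof (cases "i \<le> n")
  case True
  then have "n choose i \<le> (\<Sum>i\<le>n. n choose i)" by (intro member_le_sum) auto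
  then show ?thesis by (simp add: choose_row_sum)
qed (simp add: binomial_eq_0)

text \<open>The quotient \<open>r = (q - q 0) / x\<close> has degree below \<open>k\<close>, and
  \<open>r 0\<close> is the wanted coefficient. Its vanishing \<open>k\<close>-th difference
  expresses \<open>r 0\<close> through the values at \<open>1, ..., k\<close>, and these are
  controlled by the values of \<open>q\<close> there and by \<open>a = q 0\<close>.\<close>

lemma abs_coeff1_le:
  fixes q :: "real poly"
  assumes "degree q \<le> k" "1 \<le> k"
  shows "\<bar>coeff q 1\<bar> \<le> 2 ^ k * (\<Sum>i\<le>k. \<bar>poly q (of_nat i)\<bar>)"
proof -
  obtain a r where q: "q = pCons a r" by (cases q)
  have "degree r < k" using assms by (cases "r = 0") (auto simp: q)
  from binomial_alternating_poly[OF this]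
  have "poly r 0 = - (\<Sum>i<k. (-1) ^ Suc i * of_nat (k choose Suc i) * poly r (of_nat (Suc i)))"
    by (simp add: sum.atMost_shift)
  also have "\<bar>\<dots>\<bar> \<le> (\<Sum>i<k. \<bar>(-1) ^ Suc i * of_nat (k choose Suc i) * poly r (of_nat (Suc i))\<bar>)"
    unfolding abs_minus_cancel by (rule sum_abs)
  also have "\<dots> \<le> (\<Sum>i<k. 2 ^ k * \<bar>poly q (of_nat (Suc i))\<bar> + of_nat (k choose Suc i) * \<bar>a\<bar>)"
  proof (rule sum_mono)
    fix i
    \<comment> \<open>The nodes are at least 1, so dividing \<open>q - a\<close> by the node does
      not increase its absolute value.\<close>
    have "\<bar>poly r (of_nat (Suc i))\<bar> \<le> of_nat (Suc i) * \<bar>poly r (of_nat (Suc i))\<bar>"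
      using mult_right_mono[of 1 "of_nat (Suc i)" "\<bar>poly r (of_nat (Suc i))\<bar>"] by simp
    also have "\<dots> = \<bar>poly q (of_nat (Suc i)) - a\<bar>" by (simp add: q abs_mult)
    also have "\<dots> \<le> \<bar>poly q (of_nat (Suc i))\<bar> + \<bar>a\<bar>" by simp
    finally have *: "\<bar>poly r (of_nat (Suc i))\<bar> \<le> \<bar>poly q (of_nat (Suc i))\<bar> + \<bar>a\<bar>" .
    have "\<bar>(-1) ^ Suc i * of_nat (k choose Suc i) * poly r (of_nat (Suc i))\<bar> =
        of_nat (k choose Suc i) * \<bar>poly r (of_nat (Suc i))\<bar>"
      by (simp add: abs_mult power_abs)
    also have "\<dots> \<le> of_nat (k choose Suc i) * (\<bar>poly q (of_nat (Suc i))\<bar> + \<bar>a\<bar>)"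
      using * by (rule mult_left_mono) simp
    also have "\<dots> \<le> 2 ^ k * \<bar>poly q (of_nat (Suc i))\<bar> + of_nat (k choose Suc i) * \<bar>a\<bar>"
    proof -
      have "real (k choose Suc i) \<le> 2 ^ k"
        using choose_le_pow2[of k "Suc i"] by (metis of_nat_le_iff of_nat_numeral of_nat_power)
      from mult_right_mono[OF this, of "\<bar>poly q (of_nat (Suc i))\<bar>"]
      show ?thesis by (simp add: distrib_left)
    qed
    finally show "\<bar>(-1) ^ Suc i * of_nat (k choose Suc i) * poly r (of_nat (Suc i))\<bar>
      \<le> 2 ^ k * \<bar>poly q (of_nat (Suc i))\<bar> + of_nat (k choose Suc i) * \<bar>a\<bar>" .
  qed
  also have "\<dots> = 2 ^ k * (\<Sum>i<k. \<bar>poly q (of_nat (Suc i))\<bar>) + (\<Sum>i<k. of_nat (k choose Suc i)) * \<bar>a\<bar>"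
    by (simp add: sum.distrib sum_distrib_left sum_distrib_right)
  also have "(\<Sum>i<k. of_nat (k choose Suc i) :: real) \<le> 2 ^ k"
  proof -
    have "(\<Sum>i<k. k choose Suc i) \<le> (\<Sum>i\<le>k. k choose i)"
      by (subst sum.atMost_shift) simp
    then show ?thesis by (metis choose_row_sum of_nat_le_iff of_nat_numeral of_nat_power of_nat_sum)
  qed
  finally have "\<bar>poly r 0\<bar> \<le>
      2 ^ k * (\<Sum>i<k. \<bar>poly q (of_nat (Suc i))\<bar>) + 2 ^ k * \<bar>a\<bar>"
    by (simp add: mult_right_mono)
  also have "\<dots> = 2 ^ k * (\<Sum>i\<le>k. \<bar>poly q (of_nat i)\<bar>)"
    unfolding sum.atMost_shift by (simp add: q algebra_simps)
  finally show ?thesis by (simp add: q poly_0_coeff_0)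
qed

lemma coeff_prod_linear:
  assumes "finite S"
  shows "coeff (\<Prod>j\<in>S. [:1, c j:]) 0 = (1::real) \<and> coeff (\<Prod>j\<in>S. [:1, c j:]) 1 = (\<Sum>j\<in>S. c j)"
  using assms by (induction S rule: finite_induct) auto

lemma degree_prod_linear:
  assumes "finite S"
  shows "degree (\<Prod>j\<in>S. [:1::real, c j:]) \<le> card S"
proof -
  have "degree (\<Prod>j\<in>S. [:1::real, c j:]) \<le> (\<Sum>j\<in>S. (degree \<circ> (\<lambda>j. [:1, c j:])) j)"
    by (rule degree_prod_sum_le[OF assms])
  also have "\<dots> \<le> (\<Sum>j\<in>S. 1)" by (rule sum_mono) auto
  finally show ?thesis by simp
qed

section \<open>Random numbers read from disjoint blocks of coins\<close>

text \<open>The \<open>k\<close> bits from position \<open>p\<close> on, read in binary with the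
  most significant bit first. The bit source is a function, so that a trial can be described
  relative to its own starting point in a long coin string.\<close>

primrec bit_num :: "(nat \<Rightarrow> bool) \<Rightarrow> nat \<Rightarrow> nat \<Rightarrow> nat" where
  "bit_num r p 0 = 0"
| "bit_num r p (Suc k) = 2 * bit_num r p k + of_bool (r (p + k))"

lemma bit_num_cong: "(\<And>i. i < k \<Longrightarrow> r (p + i) = r' (p' + i)) \<Longrightarrow> bit_num r p k = bit_num r' p' k"
  by (induction k) auto

lemma sum_lessThan_double: "(\<Sum>v<2 * n. f v) = (\<Sum>v<n. f (2 * v) + f (2 * v + 1 :: nat) :: real)"
  by (induction n) (auto simp: algebra_simps)

lemma avg_bit_num: "avg k (\<lambda>rs. f (bit_num ((!) rs) 0 k)) = (\<Sum>v<2 ^ k. f v) / 2 ^ k"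
proof (induction k arbitrary: f)
  case (Suc k)
  have eq: "bit_num ((!) (rs @ [b])) 0 k = bit_num ((!) rs) 0 k" if "length rs = k" for rs b
    by (rule bit_num_cong) (use that in \<open>auto simp: nth_append\<close>)
  have "avg (Suc k) (\<lambda>rs. f (bit_num ((!) rs) 0 (Suc k))) =
      (avg k (\<lambda>rs. f (2 * bit_num ((!) rs) 0 k + 1)) + avg k (\<lambda>rs. f (2 * bit_num ((!) rs) 0 k))) / 2"
    unfolding avg_snoc by (simp add: eq nth_append cong: avg_cong)
  also have "\<dots> = (\<Sum>v<2 ^ Suc k. f v) / 2 ^ Suc k"
    using Suc.IH[of "\<lambda>v. f (2 * v + 1)"] Suc.IH[of "\<lambda>v. f (2 * v)"]
    by (simp add: sum_lessThan_double sum.distrib add_divide_distrib)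
  finally show ?case .
qed simp

text \<open>Variable \<open>j\<close> owns the bits from \<open>(j - 1) * k\<close> to
  \<open>j * k - 1\<close>. These blocks are disjoint, so the average of the product factors; the
  induction detaches the block of the last variable.\<close>

lemma avg_prod_bit_num:
  "S \<subseteq> {1..n} \<Longrightarrow>
    avg (n * k) (\<lambda>us. \<Prod>j\<in>S. f j (bit_num ((!) us) ((j - 1) * k) k)) =
    (\<Prod>j\<in>S. avg k (\<lambda>rs. f j (bit_num ((!) rs) 0 k)))"
proof (induction n arbitrary: S)
  case (Suc n)
  have fin: "finite S" using Suc.prems finite_subset by blast
  define U where "U = S - {Suc n}"
  have U: "U \<subseteq> {1..n}" using Suc.prems by (auto simp: le_Suc_eq U_def)
  have last: "bit_num ((!) (us @ rs)) (n * k) k = bit_num ((!) rs) 0 k" if "length us = n * k" for us rs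
    by (rule bit_num_cong) (use that in \<open>auto simp: nth_append\<close>)
  have rest: "(\<Prod>j\<in>U. f j (bit_num ((!) (us @ rs)) ((j - 1) * k) k)) =
      (\<Prod>j\<in>U. f j (bit_num ((!) us) ((j - 1) * k) k))" if "length us = n * k" for us rs
  proof (rule prod.cong)
    fix j assume "j \<in> U"
    then have "1 \<le> j" "j \<le> n" using U by auto
    have "bit_num ((!) (us @ rs)) ((j - 1) * k) k = bit_num ((!) us) ((j - 1) * k) k"
    proof (rule bit_num_cong)
      fix i assume "i < k"
      then have "(j - 1) * k + i < (j - 1) * k + k" by simp
      also have "\<dots> = j * k" using \<open>1 \<le> j\<close> by (cases j) auto
      also have "\<dots> \<le> n * k" using \<open>j \<le> n\<close> by simp
      finally show "(us @ rs) ! ((j - 1) * k + i) = us ! ((j - 1) * k + i)"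
        using that by (simp add: nth_append)
    qed
    then show "f j (bit_num ((!) (us @ rs)) ((j - 1) * k) k) = f j (bit_num ((!) us) ((j - 1) * k) k)" by simp
  qed simp
  have n: "Suc n * k = n * k + k" by simp
  show ?case
  proof (cases "Suc n \<in> S")
    case True
    have "avg (Suc n * k) (\<lambda>us. \<Prod>j\<in>S. f j (bit_num ((!) us) ((j - 1) * k) k)) =
      avg (n * k) (\<lambda>us. avg k (\<lambda>rs. (\<Prod>j\<in>U. f j (bit_num ((!) us) ((j - 1) * k) k)) * f (Suc n) (bit_num ((!) rs) 0 k)))"
      unfolding n avg_append U_def
      by (intro avg_cong, subst prod.remove[OF fin True])
        (simp add: last rest[unfolded U_def] del: One_nat_def)
    also have "\<dots> = avg (n * k) (\<lambda>us. (\<Prod>j\<in>U. f j (bit_num ((!) us) ((j - 1) * k) k))) *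
        avg k (\<lambda>rs. f (Suc n) (bit_num ((!) rs) 0 k))"
      unfolding avg_cmult avg_mult_right ..
    also have "\<dots> = (\<Prod>j\<in>S. avg k (\<lambda>rs. f j (bit_num ((!) rs) 0 k)))"
      unfolding Suc.IH[OF U] prod.remove[OF fin True, folded U_def] by (rule mult.commute)
    finally show ?thesis .
  next
    case False
    then have "S = U" by (simp add: U_def)
    then have "avg (Suc n * k) (\<lambda>us. \<Prod>j\<in>S. f j (bit_num ((!) us) ((j - 1) * k) k)) =
      avg (n * k) (\<lambda>us. avg k (\<lambda>rs. (\<Prod>j\<in>U. f j (bit_num ((!) us) ((j - 1) * k) k))))"
      unfolding n avg_append by (intro avg_cong) (simp add: rest del: One_nat_def)
    then show ?thesis using Suc.IH[OF U] \<open>S = U\<close> by simp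
  qed
qed simp

section \<open>The bias as a polynomial in the negation rate\<close>

text \<open>For a constraint of the instance and an assignment this is 1 if the constraint is
  satisfied and -1 if it is violated.\<close>

definition cval :: "(nat \<Rightarrow> int) \<Rightarrow> xor_constraint \<Rightarrow> int" where
  "cval y C = snd C * (\<Prod>j\<in>fst C. y j)"

definition bias :: "xor_constraint list \<Rightarrow> (nat \<Rightarrow> int) \<Rightarrow> int" where
  "bias I y = (\<Sum>l<length I. cval y (I ! l))"

text \<open>The quantity \<open>H j\<close> of the overview. It includes the factor
  \<open>y j\<close>: negating \<open>y j\<close> alone changes the bias by
  \<open>- 2 * local_bias I y j\<close>.\<close>

definition local_bias :: "xor_constraint list \<Rightarrow> (nat \<Rightarrow> int) \<Rightarrow> nat \<Rightarrow> int" where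
  "local_bias I y j = (\<Sum>l | l < length I \<and> j \<in> fst (I ! l). cval y (I ! l))"

definition start :: "(nat \<Rightarrow> bool) \<Rightarrow> nat \<Rightarrow> int" where
  "start r j = sg (r (j - 1))"

text \<open>One trial consumes \<open>n + k + n * k\<close> coin flips: \<open>n\<close> for the initial signs, \<open>k\<close> for the numerator
  of the negation rate, and \<open>k\<close> per variable for comparing with that rate.\<close>

definition improved :: "nat \<Rightarrow> nat \<Rightarrow> xor_constraint list \<Rightarrow> (nat \<Rightarrow> bool) \<Rightarrow> nat \<Rightarrow> int" where
  "improved n k I r j =
     (if bit_num r (n + k + (j - 1) * k) k < bit_num r n k \<and> local_bias I (start r) j < 0
      then - start r j else start r j)"

lemma cval_cong: "(\<And>j. j \<in> fst C \<Longrightarrow> y j = y' j) \<Longrightarrow> cval y C = cval y' C"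
  by (simp add: cval_def)

context
  fixes n k :: nat and I :: "xor_constraint list"
  assumes inst: "max_kxor n k I"
begin

lemma k_pos: "1 \<le> k" and I_nonempty: "I \<noteq> []" and scopes_distinct: "distinct (map fst I)"
  using inst by (auto simp: max_kxor_def)

lemma scope:
  assumes "l < length I"
  shows "fst (I ! l) \<subseteq> {1..n}" "card (fst (I ! l)) = k" "snd (I ! l) \<in> {1, -1}"
    "finite (fst (I ! l))"
proof -
  obtain S b where C: "I ! l = (S, b)" by (cases "I ! l")
  have "\<forall>(S, b)\<in>set I. S \<subseteq> {1..n} \<and> card S = k \<and> b \<in> {1, -1}"
    using inst by (simp add: max_kxor_def)
  then have "S \<subseteq> {1..n} \<and> card S = k \<and> b \<in> {1, -1}"
    using nth_mem[OF assms] unfolding C by blast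
  then show "fst (I ! l) \<subseteq> {1..n}" "card (fst (I ! l)) = k" "snd (I ! l) \<in> {1, -1}"
    by (simp_all add: C)
  then show "finite (fst (I ! l))" using finite_subset by blast
qed

lemma scope_cong:
  assumes "\<And>j. j \<in> {1..n} \<Longrightarrow> y j = y' j" "l < length I"
  shows "cval y (I ! l) = cval y' (I ! l)"
  by (rule cval_cong) (use assms scope(1) in blast)

lemma bias_cong:
  assumes "\<And>j. j \<in> {1..n} \<Longrightarrow> y j = y' j"
  shows "bias I y = bias I y'"
  unfolding bias_def by (rule sum.cong) (auto intro: scope_cong assms)

lemma local_bias_cong:
  assumes "\<And>j. j \<in> {1..n} \<Longrightarrow> y j = y' j"
  shows "local_bias I y j = local_bias I y' j"
  unfolding local_bias_def by (rule sum.cong) (auto intro: scope_cong assms)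

text \<open>Double counting of the pairs of a variable and a constraint containing it. The
  polymorphic type serves integer sums of local biases, natural sums of degrees and real sums of
  coefficients.\<close>

lemma sum_incidence:
  fixes g :: "nat \<Rightarrow> nat \<Rightarrow> 'a::comm_monoid_add"
  shows "(\<Sum>j\<in>{1..n}. \<Sum>l | l < length I \<and> j \<in> fst (I ! l). g j l) =
    (\<Sum>l<length I. \<Sum>j\<in>fst (I ! l). g j l)"
proof -
  have "(\<Sum>j\<in>{1..n}. \<Sum>l | l < length I \<and> j \<in> fst (I ! l). g j l) =
    (\<Sum>l\<in>{..<length I}. \<Sum>j | j \<in> {1..n} \<and> j \<in> fst (I ! l). g j l)"
    using sum.swap_restrict[of "{1..n}" "{..<length I}" g "\<lambda>j l. j \<in> fst (I ! l)"] by simp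
  also have "\<dots> = (\<Sum>l<length I. \<Sum>j\<in>fst (I ! l). g j l)"
  proof (intro sum.cong refl)
    fix l assume "l \<in> {..<length I}"
    then show "{j \<in> {1..n}. j \<in> fst (I ! l)} = fst (I ! l)" using scope(1)[of l] by blast
  qed
  finally show ?thesis .
qed

text \<open>Euler's identity for the bias, which is homogeneous of degree \<open>k\<close>: each
  monomial is counted once for each of its \<open>k\<close> variables.\<close>

lemma sum_local_bias: "(\<Sum>j\<in>{1..n}. local_bias I y j) = int k * bias I y"
proof -
  have "(\<Sum>j\<in>{1..n}. local_bias I y j) = (\<Sum>l<length I. \<Sum>j\<in>fst (I ! l). cval y (I ! l))"
    unfolding local_bias_def by (rule sum_incidence)
  also have "\<dots> = (\<Sum>l<length I. int k * cval y (I ! l))" by (simp add: scope(2))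
  finally show ?thesis by (simp add: bias_def sum_distrib_left)
qed

lemma sum_degree: "(\<Sum>j\<in>{1..n}. var_degree I j) = k * length I"
proof -
  have "(\<Sum>j\<in>{1..n}. var_degree I j) = (\<Sum>l<length I. \<Sum>j\<in>fst (I ! l). 1)"
    unfolding var_degree_def card_eq_sum by (rule sum_incidence)
  also have "\<dots> = (\<Sum>l<length I. k)" using scope(2) by simp
  finally show ?thesis by simp
qed

text \<open>A sign negated with probability \<open>r\<close> keeps the factor
  \<open>1 - 2 * r\<close> in expectation; \<open>down\<close> is the slope of this factor, 0 for
  variables that are never negated.\<close>

definition down :: "(nat \<Rightarrow> int) \<Rightarrow> nat \<Rightarrow> real" where
  "down y j = (if local_bias I y j < 0 then 2 else 0)"

text \<open>The value of \<open>interp y\<close> at \<open>x\<close> is the expected bias after negating each \<open>j\<close> with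
  \<open>local_bias I y j < 0\<close> with probability \<open>x / 2 ^ k\<close>.\<close>

definition interp :: "(nat \<Rightarrow> int) \<Rightarrow> real poly" where
  "interp y = (\<Sum>l<length I. smult (of_int (cval y (I ! l)))
     (\<Prod>j\<in>fst (I ! l). [:1, - (down y j / 2 ^ k):]))"

lemma poly_interp:
  "poly (interp y) x = (\<Sum>l<length I. of_int (cval y (I ! l)) * (\<Prod>j\<in>fst (I ! l). 1 - down y j / 2 ^ k * x))"
  by (simp add: interp_def poly_sum poly_prod mult.commute)

lemma sum_abs_local_bias_le:
  "(\<Sum>j\<in>{1..n}. \<bar>real_of_int (local_bias I y j)\<bar>) \<le> 2 * 4 ^ k * (\<Sum>i\<le>k. \<bar>poly (interp y) (real i)\<bar>)"
proof -
  have deg: "degree (interp y) \<le> k"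
  proof -
    have "degree (smult (of_int (cval y (I ! l)))
      (\<Prod>j\<in>fst (I ! l). [:1, - (down y j / 2 ^ k):])) \<le> k" if "l < length I" for l
    proof -
      have "degree (smult (of_int (cval y (I ! l))) (\<Prod>j\<in>fst (I ! l). [:1, - (down y j / 2 ^ k):]))
         \<le> degree (\<Prod>j\<in>fst (I ! l). [:1, - (down y j / 2 ^ k):])" by (rule degree_smult_le)
      also have "\<dots> \<le> k"
        using degree_prod_linear[OF scope(4)[OF that], of "\<lambda>j. - (down y j / 2 ^ k)"] scope(2)[OF that] by simp
      finally show ?thesis .
    qed
    then show ?thesis unfolding interp_def by (intro degree_sum_le) auto
  qed
  have "coeff (interp y) 1 =
      (\<Sum>l<length I. of_int (cval y (I ! l)) * (\<Sum>j\<in>fst (I ! l). - (down y j / 2 ^ k)))"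
    unfolding interp_def coeff_sum coeff_smult
    by (intro sum.cong refl) (simp only: coeff_prod_linear scope(4) lessThan_iff)
  also have "\<dots> = (\<Sum>l<length I. \<Sum>j\<in>fst (I ! l). - (down y j / 2 ^ k * of_int (cval y (I ! l))))"
    by (simp add: sum_distrib_left mult.commute)
  also have "\<dots> = (\<Sum>j\<in>{1..n}. \<Sum>l | l < length I \<and> j \<in> fst (I ! l). - (down y j / 2 ^ k * of_int (cval y (I ! l))))"
    by (rule sum_incidence[symmetric])
  also have "\<dots> = (\<Sum>j\<in>{1..n}. - (down y j / 2 ^ k * of_int (local_bias I y j)))"
    by (simp add: local_bias_def sum_distrib_left sum_negf)
  finally have c1: "2 ^ k * coeff (interp y) 1 = (\<Sum>j\<in>{1..n}. - (down y j * of_int (local_bias I y j)))"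
    by (simp add: sum_distrib_left)
  have b0: "poly (interp y) 0 = of_int (bias I y)"
    by (simp add: poly_interp bias_def)
  \<comment> \<open>Pointwise, the absolute value of \<open>h\<close> is \<open>h\<close> minus
    \<open>2 * h\<close> where \<open>h\<close> is negative. The first part sums to \<open>k\<close>
    times the value at 0, the second to \<open>2 ^ k\<close> times the linear coefficient, the
    factor undoing the rescaling of the rate.\<close>
  have "(\<Sum>j\<in>{1..n}. \<bar>real_of_int (local_bias I y j)\<bar>) =
      (\<Sum>j\<in>{1..n}. of_int (local_bias I y j) + - (down y j * of_int (local_bias I y j)))"
    by (rule sum.cong) (auto simp: down_def)
  also have "\<dots> = real_of_int (\<Sum>j\<in>{1..n}. local_bias I y j) + 2 ^ k * coeff (interp y) 1"
    unfolding c1 sum.distrib by simp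
  also have "\<dots> = k * poly (interp y) 0 + 2 ^ k * coeff (interp y) 1"
    unfolding sum_local_bias b0 by simp
  also have "\<dots> \<le> k * (\<Sum>i\<le>k. \<bar>poly (interp y) (real i)\<bar>) +
      2 ^ k * (2 ^ k * (\<Sum>i\<le>k. \<bar>poly (interp y) (real i)\<bar>))"
  proof (intro add_mono mult_left_mono)
    have "\<bar>poly (interp y) (real 0)\<bar> \<le> (\<Sum>i\<le>k. \<bar>poly (interp y) (real i)\<bar>)"
      by (rule member_le_sum) auto
    then show "poly (interp y) 0 \<le> (\<Sum>i\<le>k. \<bar>poly (interp y) (real i)\<bar>)" by simp
    show "coeff (interp y) 1 \<le> 2 ^ k * (\<Sum>i\<le>k. \<bar>poly (interp y) (real i)\<bar>)"
      using abs_coeff1_le[OF deg k_pos] by simp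
  qed auto
  also have "\<dots> = (real k + 4 ^ k) * (\<Sum>i\<le>k. \<bar>poly (interp y) (real i)\<bar>)"
    by (simp add: algebra_simps power_mult_distrib[symmetric])
  also have "\<dots> \<le> 2 * 4 ^ k * (\<Sum>i\<le>k. \<bar>poly (interp y) (real i)\<bar>)"
  proof (rule mult_right_mono)
    have "k \<le> 4 ^ k" using less_exp[of k] power_mono[of 2 "4::nat" k] by linarith
    then have "real k \<le> 4 ^ k" by (metis of_nat_le_iff of_nat_numeral of_nat_power)
    then show "real k + 4 ^ k \<le> 2 * 4 ^ k" by simp
  qed (simp add: sum_nonneg)
  finally show ?thesis .
qed

text \<open>The first moment of the local bias at \<open>j\<close> is at least
  \<open>sqrt (deg j)\<close> up to \<open>3 ^ (k + 1)\<close>. The degree bound trades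
  \<open>sqrt (deg j)\<close> for \<open>deg j / sqrt D\<close>, and the degrees sum to
  \<open>k * length I\<close>.\<close>

lemma avg_sum_abs_local_bias_ge:
  assumes D: "\<forall>i\<in>{1..n}. var_degree I i \<le> D" "1 \<le> D"
  shows "real k * real (length I) / (3 * 3 ^ k * sqrt D) \<le>
    avg n (\<lambda>ys. \<Sum>j\<in>{1..n}. \<bar>real_of_int (local_bias I (start ((!) ys)) j)\<bar>)"
proof -
  have one: "real (var_degree I j) / sqrt D \<le> 3 * 3 ^ k * avg n (\<lambda>ys. \<bar>real_of_int (local_bias I (start ((!) ys)) j)\<bar>)"
    if j: "j \<in> {1..n}" for j
  proof (cases "var_degree I j = 0")
    case True
    then show ?thesis by (simp add: avg_nonneg)
  next
    case False
    define A where "A = {l. l < length I \<and> j \<in> fst (I ! l)}"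
    define f where "f = (\<lambda>ys. \<Sum>l\<in>A. real_of_int (snd (I ! l)) * chi (fst (I ! l)) ys)"
    have A: "finite A" "card A = var_degree I j" by (simp_all add: A_def var_degree_def)
    have f: "real_of_int (local_bias I (start ((!) ys)) j) = f ys" for ys
      by (simp add: local_bias_def f_def A_def cval_def chi_def start_def)
    have "lowdeg n k f" unfolding f_def
      by (intro lowdeg_sum lowdeg_chi A) (use scope in \<open>auto simp: A_def\<close>)
    moreover have "avg n (\<lambda>ys. (f ys)\<^sup>2) = real (card A)"
      unfolding f_def
    proof (rule avg_square_chi_sum)
      show "inj_on (\<lambda>l. fst (I ! l)) A"
        using scopes_distinct by (auto simp: inj_on_def A_def distinct_conv_nth)
      show "fst (I ! l) \<subseteq> {1..n}" if "l \<in> A" for l using scope(1) that by (auto simp: A_def)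
      show "(real_of_int (snd (I ! l)))\<^sup>2 = 1" if "l \<in> A" for l
        using scope(3)[of l] that by (auto simp: A_def)
    qed (rule A)
    ultimately have *: "sqrt (real (card A)) \<le> 3 * 3 ^ k * avg n (\<lambda>ys. \<bar>f ys\<bar>)"
      using False A by (intro sqrt_second_moment_le) auto
    define v where "v = real (card A)"
    have v: "0 < v" "v \<le> D" using False A D(1) j by (auto simp: v_def)
    have "v / sqrt D \<le> v / sqrt v" using v by (intro divide_left_mono) auto
    also have "\<dots> = sqrt v" using v by (simp add: real_div_sqrt)
    finally show ?thesis using * by (simp add: f v_def A)
  qed
  have "real k * real (length I) / sqrt D = (\<Sum>j\<in>{1..n}. real (var_degree I j) / sqrt D)"
    using sum_degree by (metis of_nat_mult of_nat_sum sum_divide_distrib)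
  also have "\<dots> \<le> (\<Sum>j\<in>{1..n}. 3 * 3 ^ k * avg n (\<lambda>ys. \<bar>real_of_int (local_bias I (start ((!) ys)) j)\<bar>))"
    by (rule sum_mono) (rule one)
  also have "\<dots> = 3 * 3 ^ k * avg n (\<lambda>ys. \<Sum>j\<in>{1..n}. \<bar>real_of_int (local_bias I (start ((!) ys)) j)\<bar>)"
    by (simp add: avg_sum sum_distrib_left)
  finally show ?thesis using D(2) by (simp add: field_simps)
qed

text \<open>With the signs \<open>ys\<close> and the rate \<open>rs\<close> fixed, only the
  comparison bits are random. They act independently on the variables of a scope, and each
  contributes its mean factor, so the mean of a monomial is a product of linear factors in the
  rate.\<close>

lemma avg_improved:
  assumes "length ys = n" "length rs = k"
  shows "avg (n * k) (\<lambda>us. real_of_int (bias I (improved n k I ((!) (ys @ rs @ us))))) =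
    poly (interp (start ((!) ys))) (real (bit_num ((!) rs) 0 k))"
proof -
  define y where "y = start ((!) ys)"
  define v where "v = bit_num ((!) rs) 0 k"
  \<comment> \<open>The factor -1 or 1 applied to the sign of \<open>j\<close> when its comparison
    number is \<open>u\<close>.\<close>
  define f where "f = (\<lambda>j u. 1 - down y j * of_bool (u < v))"
  \<comment> \<open>Ensures that exactly \<open>v\<close> of the \<open>2 ^ k\<close> comparison
    numbers lie below \<open>v\<close>, so that the negation probability is
    \<open>v / 2 ^ k\<close>.\<close>
  have v_less: "v < 2 ^ k"
  proof -
    have "bit_num r p k < 2 ^ k" for r p by (induction k) (auto simp: of_bool_def)
    then show ?thesis by (simp add: v_def)
  qed
  have st: "start ((!) (ys @ rs @ us)) j = y j" if "j \<in> {1..n}" for j us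
    using that assms by (simp add: start_def y_def nth_append) linarith
  have local_bias: "local_bias I (start ((!) (ys @ rs @ us))) j = local_bias I y j" for j us
    by (rule local_bias_cong) (rule st)
  have bnr: "bit_num ((!) (ys @ rs @ us)) n k = v" for us
    unfolding v_def by (rule bit_num_cong) (use assms in \<open>auto simp: nth_append\<close>)
  have bnu: "bit_num ((!) (ys @ rs @ us)) (n + k + j * k) k = bit_num ((!) us) (j * k) k" for us j
    by (rule bit_num_cong) (use assms in \<open>auto simp: nth_append\<close>)
  have imp: "real_of_int (improved n k I ((!) (ys @ rs @ us)) j) =
      of_int (y j) * f j (bit_num ((!) us) ((j - 1) * k) k)" if "j \<in> {1..n}" for j us
    using that by (simp add: improved_def bnr bnu local_bias st f_def down_def)
  have val: "real_of_int (cval (improved n k I ((!) (ys @ rs @ us))) (I ! l)) =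
      of_int (cval y (I ! l)) * (\<Prod>j\<in>fst (I ! l). f j (bit_num ((!) us) ((j - 1) * k) k))"
    if "l < length I" for l us
  proof -
    have "(\<Prod>j\<in>fst (I ! l). real_of_int (improved n k I ((!) (ys @ rs @ us)) j)) =
        (\<Prod>j\<in>fst (I ! l). of_int (y j) * f j (bit_num ((!) us) ((j - 1) * k) k))"
      by (rule prod.cong) (use imp scope(1)[OF that] in blast)+
    then show ?thesis by (simp add: cval_def prod.distrib)
  qed
  have rate: "avg k (\<lambda>rs. f j (bit_num ((!) rs) 0 k)) = 1 - down y j / 2 ^ k * real v" for j
  proof -
    have "(\<Sum>u<2 ^ k. f j u) = 2 ^ k - down y j * (\<Sum>u<2 ^ k. of_bool (u < v))"
      by (simp add: f_def sum_subtractf sum_distrib_left)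
    also have "(\<Sum>u<2 ^ k. of_bool (u < v)) = (\<Sum>u<v. 1 :: real)"
      by (rule sum.mono_neutral_cong_right) (use v_less in auto)
    finally show ?thesis by (simp add: avg_bit_num diff_divide_distrib)
  qed
  have "avg (n * k) (\<lambda>us. real_of_int (bias I (improved n k I ((!) (ys @ rs @ us))))) =
    (\<Sum>l<length I. avg (n * k) (\<lambda>us. of_int (cval y (I ! l)) *
      (\<Prod>j\<in>fst (I ! l). f j (bit_num ((!) us) ((j - 1) * k) k))))"
    by (subst avg_sum[symmetric]) (simp_all add: bias_def val)
  also have "\<dots> = poly (interp y) (real v)"
    unfolding poly_interp by (intro sum.cong refl) (simp add: avg_cmult avg_prod_bit_num scope(1) rate del: One_nat_def)
  finally show ?thesis by (simp add: y_def v_def)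
qed

text \<open>The absolute value of a conditional mean is at most the conditional mean of the absolute
  value, so averaging over the rate loses only the factor \<open>2 ^ k\<close>. The constant is
  \<open>6 * 24 ^ k = (3 * 3 ^ k) * (2 * 4 ^ k) * 2 ^ k\<close>.\<close>

lemma avg_abs_bias_ge:
  assumes D: "\<forall>i\<in>{1..n}. var_degree I i \<le> D" "1 \<le> D"
  shows "real (length I) / (6 * 24 ^ k * sqrt D) \<le>
    avg (n + k + n * k) (\<lambda>bs. \<bar>real_of_int (bias I (improved n k I ((!) bs)))\<bar>)"
proof -
  have inner: "(\<Sum>j\<in>{1..n}. \<bar>real_of_int (local_bias I (start ((!) ys)) j)\<bar>) / (2 * 8 ^ k) \<le>
     avg k (\<lambda>rs. avg (n * k) (\<lambda>us. \<bar>real_of_int (bias I (improved n k I ((!) (ys @ rs @ us))))\<bar>))"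
    (is "?s / _ \<le> ?rhs") if "length ys = n" for ys
  proof -
    let ?q = "\<lambda>i. \<bar>poly (interp (start ((!) ys))) (real i)\<bar>"
    have "?s \<le> 2 * 4 ^ k * (\<Sum>i\<le>k. ?q i)" by (rule sum_abs_local_bias_le)
    \<comment> \<open>The nodes \<open>0, ..., k\<close> are among the equally likely numerators of
      the rate.\<close>
    also have "(\<Sum>i\<le>k. ?q i) \<le> (\<Sum>i<2 ^ k. ?q i)"
    proof (rule sum_mono2)
      have "k < 2 ^ k" by (rule less_exp)
      then show "{..k} \<subseteq> {..<2 ^ k}" by (auto simp only: atMost_iff lessThan_iff intro: le_less_trans)
    qed auto
    also have "\<dots> = 2 ^ k * avg k (\<lambda>rs. ?q (bit_num ((!) rs) 0 k))"
      using avg_bit_num[of k ?q] by simp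
    also have "avg k (\<lambda>rs. ?q (bit_num ((!) rs) 0 k)) \<le> ?rhs"
      by (rule avg_mono) (simp add: avg_improved[OF that, symmetric] abs_avg_le)
    finally have "?s \<le> 2 * 4 ^ k * (2 ^ k * ?rhs)" by simp
    also have "\<dots> = 2 * 8 ^ k * ?rhs" by (simp add: power_mult_distrib[symmetric])
    finally show ?thesis by (simp add: field_simps)
  qed
  have "real (length I) * 1 \<le> real (length I) * real k"
    using k_pos by (intro mult_left_mono) auto
  then have "real (length I) / (6 * 24 ^ k * sqrt D) \<le> real k * real (length I) / (6 * 24 ^ k * sqrt D)"
    by (intro divide_right_mono) (auto simp: mult.commute)
  also have "\<dots> = real k * real (length I) / (6 * (3 ^ k * 8 ^ k) * sqrt D)"
    by (simp add: power_mult_distrib[symmetric])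
  also have "\<dots> =
      1 / (2 * 8 ^ k) * (real k * real (length I) / (3 * 3 ^ k * sqrt D))" by simp
  also have "\<dots> \<le> 1 / (2 * 8 ^ k) * avg n (\<lambda>ys. \<Sum>j\<in>{1..n}. \<bar>real_of_int (local_bias I (start ((!) ys)) j)\<bar>)"
    by (intro mult_left_mono avg_sum_abs_local_bias_ge D) simp
  also have "\<dots> = avg n (\<lambda>ys. (\<Sum>j\<in>{1..n}. \<bar>real_of_int (local_bias I (start ((!) ys)) j)\<bar>) / (2 * 8 ^ k))"
    by (simp add: avg_cmult[symmetric])
  also have "\<dots> \<le> avg n (\<lambda>ys. avg k (\<lambda>rs. avg (n * k) (\<lambda>us. \<bar>real_of_int (bias I (improved n k I ((!) (ys @ rs @ us))))\<bar>)))"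
    by (rule avg_mono) (rule inner)
  also have "\<dots> = avg (n + k + n * k) (\<lambda>bs. \<bar>real_of_int (bias I (improved n k I ((!) bs)))\<bar>)"
    by (simp add: avg_append add.assoc)
  finally show ?thesis .
qed

end

section \<open>Amplification\<close>

text \<open>Reverse Markov inequality: \<open>f\<close> is below \<open>t\<close> outside the event
  and at most \<open>b\<close> on it, so a mean of at least \<open>2 * t\<close> forces the event to
  have mass \<open>t / b\<close>.\<close>

lemma avg_of_bool_ge:
  assumes X: "\<And>xs. length xs = n \<Longrightarrow> f xs \<le> b" and b: "0 < b"
    and t: "2 * t \<le> avg n f" "0 \<le> t"
  shows "t / b \<le> avg n (\<lambda>xs. of_bool (t \<le> f xs))"
proof -
  have "avg n f \<le> avg n (\<lambda>xs. t + b * of_bool (t \<le> f xs))"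
  proof (rule avg_mono)
    fix xs :: "bool list" assume "length xs = n"
    then show "f xs \<le> t + b * of_bool (t \<le> f xs)" using X[of xs] t by simp
  qed
  then have "t \<le> b * avg n (\<lambda>xs. of_bool (t \<le> f xs))"
    using t by (simp add: avg_add avg_cmult)
  then show ?thesis using b by (simp add: field_simps)
qed

text \<open>Independence of the trials: \<open>G\<close> sees only the \<open>L\<close> bits of its
  own block. The extra \<open>E\<close> bits allow a coin string longer than the blocks
  require.\<close>

lemma avg_all_blocks_le:
  assumes G: "\<And>r r'. (\<And>i. i < L \<Longrightarrow> r i = r' i) \<Longrightarrow> G r = G r'"
    and p: "avg L (\<lambda>bs. of_bool (G ((!) bs))) \<le> q"
  shows "avg (T * L + E) (\<lambda>bs. of_bool (\<forall>t<T. G (\<lambda>i. bs ! (t * L + i)))) \<le> q ^ T"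
proof (induction T)
  case (Suc T)
  have q: "0 \<le> q"
    by (rule order_trans[OF _ p]) (simp add: avg_nonneg)
  have split: "of_bool (\<forall>t<Suc T. G (\<lambda>i. (xs @ ys) ! (t * L + i))) =
      (of_bool (G ((!) xs)) * of_bool (\<forall>t<T. G (\<lambda>i. ys ! (t * L + i))) :: real)"
    if "length xs = L" for xs ys
  proof -
    have "G (\<lambda>i. (xs @ ys) ! (0 * L + i)) = G ((!) xs)"
      by (rule G) (use that in \<open>simp add: nth_append\<close>)
    moreover have "(xs @ ys) ! (Suc t * L + i) = ys ! (t * L + i)" for t i
      using that by (simp add: nth_append)
    ultimately show ?thesis by (simp add: All_less_Suc2 del: mult_Suc)
  qed
  have "Suc T * L + E = L + (T * L + E)" by simp
  then have "avg (Suc T * L + E) (\<lambda>bs. of_bool (\<forall>t<Suc T. G (\<lambda>i. bs ! (t * L + i)))) =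
      avg L (\<lambda>xs. avg (T * L + E) (\<lambda>ys. of_bool (G ((!) xs)) * of_bool (\<forall>t<T. G (\<lambda>i. ys ! (t * L + i)))))"
    by (simp only: avg_append) (intro avg_cong split)
  also have "\<dots> = avg L (\<lambda>bs. of_bool (G ((!) bs))) *
      avg (T * L + E) (\<lambda>bs. of_bool (\<forall>t<T. G (\<lambda>i. bs ! (t * L + i))))"
    unfolding avg_cmult avg_mult_right ..
  also have "\<dots> \<le> q * q ^ T"
    by (rule mult_mono[OF p Suc.IH]) (use q in \<open>auto intro: avg_nonneg\<close>)
  finally show ?case by simp
qed simp

section \<open>Success probability of one trial and of many\<close>

text \<open>Half of the mean absolute bias \<open>m / (6 * 24 ^ k * sqrt D)\<close>, divided by
  \<open>2 * m\<close> because the bias is \<open>2 * m * (val - 1 / 2)\<close>.\<close>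

definition advantage :: "nat \<Rightarrow> real" where
  "advantage k = 1 / 24 ^ (k + 1)"

text \<open>Computable with additions only and within the time budget. Its powers serve as the
  number of trials, as the number of coins and as the time bound.\<close>

definition magnitude :: "nat \<Rightarrow> nat \<Rightarrow> nat \<Rightarrow> nat" where
  "magnitude n m k = n + m + 2 ^ k"

context
  fixes n k :: nat and I :: "xor_constraint list"
  assumes inst: "max_kxor n k I"
begin

lemma cval_sign:
  assumes "assignment n x" "l < length I"
  shows "cval x (I ! l) \<in> {1, -1}"
proof -
  have "(\<Prod>j\<in>S. x j) \<in> {1, -1}" if "finite S" "S \<subseteq> {1..n}" for S
    using that
  proof (induction S rule: finite_induct)
    case (insert j S)
    then show ?case using assms(1) by (auto simp: assignment_def)
  qed simp
  from this[of "fst (I ! l)"] show ?thesis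
    using scope[OF inst assms(2)] by (auto simp: cval_def)
qed

lemma bias_eq:
  assumes "assignment n x"
  shows "real_of_int (bias I x) = 2 * real (length I) * (val I x - 1 / 2)"
proof -
  have sat: "cval x (I ! l) = 2 * of_bool (satisfied x (I ! l)) - 1" if "l < length I" for l
    using cval_sign[OF assms that] by (auto simp: satisfied_def cval_def)
  have "bias I x = (\<Sum>l<length I. 2 * of_bool (satisfied x (I ! l)) - 1)"
    unfolding bias_def by (rule sum.cong) (auto simp: sat)
  also have "\<dots> = 2 * (\<Sum>l<length I. of_bool (satisfied x (I ! l))) - int (length I)"
    by (simp add: sum_subtractf sum_distrib_left)
  also have "(\<Sum>l<length I. of_bool (satisfied x (I ! l)) :: int) =
      int (card {l. l < length I \<and> satisfied x (I ! l)})"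
    by (simp add: of_bool_def sum.If_cases Int_def)
  finally have "real_of_int (bias I x) =
      2 * real (card {l. l < length I \<and> satisfied x (I ! l)}) - real (length I)" by simp
  moreover have "real (length I) * val I x = real (card {l. l < length I \<and> satisfied x (I ! l)})"
    using I_nonempty[OF inst] by (simp add: val_def)
  ultimately show ?thesis by (simp add: algebra_simps)
qed

lemma abs_bias_le:
  assumes "assignment n x"
  shows "\<bar>bias I x\<bar> \<le> int (length I)"
proof -
  have "\<bar>bias I x\<bar> \<le> (\<Sum>l<length I. \<bar>cval x (I ! l)\<bar>)"
    unfolding bias_def by (rule sum_abs)
  also have "\<dots> \<le> (\<Sum>l<length I. 1)"
  proof (rule sum_mono)
    fix l assume "l \<in> {..<length I}"
    then show "\<bar>cval x (I ! l)\<bar> \<le> 1" using cval_sign[OF assms, of l] by auto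
  qed
  finally show ?thesis by simp
qed

lemma bias_uminus: "bias I (\<lambda>j. - x j) = (-1) ^ k * bias I x"
proof -
  have "cval (\<lambda>j. - x j) (I ! l) = (-1) ^ k * cval x (I ! l)" if "l < length I" for l
    using scope(2)[OF inst that] by (simp add: cval_def prod_uminus)
  then show ?thesis by (simp add: bias_def sum_distrib_left)
qed

lemma assignment_improved: "assignment n (improved n k I r)"
  using sg_cases by (auto simp: assignment_def improved_def start_def)

lemma bias_improved_cong:
  assumes "\<And>i. i < n + k + n * k \<Longrightarrow> r i = r' i"
  shows "bias I (improved n k I r) = bias I (improved n k I r')"
proof (rule bias_cong[OF inst])
  have st: "start r j = start r' j" if "j \<in> {1..n}" for j
  proof -
    have "j - 1 < n + k + n * k" using that by auto
    then show ?thesis using assms by (simp add: start_def)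
  qed
  fix j assume j: "j \<in> {1..n}"
  have "bit_num r n k = bit_num r' n k" by (rule bit_num_cong) (simp add: assms)
  moreover have "bit_num r (n + k + (j - 1) * k) k = bit_num r' (n + k + (j - 1) * k) k"
  proof (rule bit_num_cong, rule assms)
    fix i assume "i < k"
    then have "(j - 1) * k + i < (j - 1) * k + k" by simp
    also have "\<dots> = j * k" using j by (cases j) auto
    also have "\<dots> \<le> n * k" using j by simp
    finally show "n + k + (j - 1) * k + i < n + k + n * k" by simp
  qed
  moreover have "local_bias I (start r) j = local_bias I (start r') j" by (rule local_bias_cong[OF inst st])
  ultimately show "improved n k I r j = improved n k I r' j"
    using st[OF j] by (simp add: improved_def)
qed

lemma prob_trial_ge:
  assumes D: "\<forall>i\<in>{1..n}. var_degree I i \<le> D" "1 \<le> D"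
  shows "1 / (12 * 24 ^ k * sqrt D) \<le>
    avg (n + k + n * k) (\<lambda>bs. of_bool
      (advantage k / sqrt D \<le> \<bar>val I (improved n k I ((!) bs)) - 1 / 2\<bar>))"
proof -
  let ?m = "real (length I)"
  have m: "0 < ?m" using I_nonempty[OF inst] by simp
  define t where "t = ?m / (12 * 24 ^ k * sqrt D)"
  have "t / ?m \<le> avg (n + k + n * k) (\<lambda>bs. of_bool (t \<le> \<bar>real_of_int (bias I (improved n k I ((!) bs)))\<bar>))"
  proof (rule avg_of_bool_ge)
    fix bs
    show "\<bar>real_of_int (bias I (improved n k I ((!) bs)))\<bar> \<le> ?m"
      using abs_bias_le[OF assignment_improved, of "(!) bs"] by linarith
    show "2 * t \<le> avg (n + k + n * k) (\<lambda>bs. \<bar>real_of_int (bias I (improved n k I ((!) bs)))\<bar>)"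
      using avg_abs_bias_ge[OF inst D] by (simp add: t_def mult.assoc mult.left_commute mult.commute)
  qed (use m in \<open>auto simp: t_def\<close>)
  moreover have "t \<le> \<bar>real_of_int (bias I (improved n k I r))\<bar> \<longleftrightarrow>
      advantage k / sqrt D \<le> \<bar>val I (improved n k I r) - 1 / 2\<bar>" for r
  proof -
    have "t = 2 * ?m * (advantage k / sqrt D)" by (simp add: t_def advantage_def)
    then show ?thesis
      unfolding bias_eq[OF assignment_improved] abs_mult using m
      by (simp only: abs_of_pos mult_pos_pos zero_less_numeral mult_le_cancel_left_pos)
  qed
  ultimately show ?thesis using m by (simp add: t_def)
qed

lemma prob_some_trial_ge:
  fixes a :: nat
  assumes D: "\<forall>i\<in>{1..n}. var_degree I i \<le> D"
  defines "L \<equiv> n + k + n * k" and "T \<equiv> magnitude n (length I) k ^ (a + 9)"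
  shows "1 - 1 / real (n + length I) ^ a \<le>
    avg (T * L + E) (\<lambda>bs. of_bool (\<exists>t<T.
      advantage k / sqrt D \<le> \<bar>val I (improved n k I (\<lambda>i. bs ! (t * L + i))) - 1 / 2\<bar>))"
proof -
  let ?m = "length I"
  define M where "M = real (magnitude n ?m k)"
  have m: "1 \<le> ?m" using I_nonempty[OF inst] by (cases I) auto
  \<comment> \<open>\<open>D\<close> is an arbitrary upper bound; capping it keeps the success probability of a trial from
    degrading with \<open>D\<close>.\<close>
  define D' where "D' = min D ?m"
  have vm: "var_degree I i \<le> ?m" for i
    unfolding var_degree_def using card_mono[of "{..<?m}" "{l. l < ?m \<and> i \<in> fst (I ! l)}"] by auto
  have D': "\<forall>i\<in>{1..n}. var_degree I i \<le> D'" using D vm by (simp add: D'_def)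
  have "1 \<le> D'"
  proof (rule ccontr)
    assume "\<not> 1 \<le> D'"
    then have "(\<Sum>j\<in>{1..n}. var_degree I j) = 0"
      using D' by (intro sum.neutral) (auto dest!: bspec)
    then show False using sum_degree[OF inst] k_pos[OF inst] m by simp
  qed
  define p where "p = 1 / (12 * 24 ^ k * sqrt D')"
  define ok where "ok = (\<lambda>r. advantage k / sqrt D' \<le> \<bar>val I (improved n k I r) - 1 / 2\<bar>)"
  have p: "p \<le> avg L (\<lambda>bs. of_bool (ok ((!) bs)))"
    using prob_trial_ge[OF D' \<open>1 \<le> D'\<close>] by (simp add: p_def ok_def L_def)
  have p1: "p \<le> 1"
    using order_trans[OF p avg_mono[of L _ "\<lambda>_. 1"]] by (auto simp: of_bool_def)
  have miss: "avg L (\<lambda>bs. of_bool (\<not> ok ((!) bs))) \<le> 1 - p"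
    using p by (simp add: of_bool_not_iff avg_diff)
  have dep: "(\<not> ok r) = (\<not> ok r')" if "\<And>i. i < L \<Longrightarrow> r i = r' i" for r r'
  proof -
    have "bias I (improved n k I r) = bias I (improved n k I r')"
      by (rule bias_improved_cong) (use that in \<open>simp add: L_def\<close>)
    then have "2 * real ?m * (val I (improved n k I r) - 1 / 2) =
        2 * real ?m * (val I (improved n k I r') - 1 / 2)"
      unfolding bias_eq[OF assignment_improved, symmetric] by simp
    then have "val I (improved n k I r) = val I (improved n k I r')" using m by auto
    then show ?thesis by (simp add: ok_def)
  qed
  have fail: "avg (T * L + E) (\<lambda>bs. of_bool (\<forall>t<T. \<not> ok (\<lambda>i. bs ! (t * L + i)))) \<le> (1 - p) ^ T"
    by (rule avg_all_blocks_le[where G = "\<lambda>r. \<not> ok r", OF dep miss])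
  have n: "1 \<le> n"
  proof (rule ccontr)
    assume "\<not> 1 \<le> n"
    then have "(\<Sum>j\<in>{1..n}. var_degree I j) = 0" by simp
    then show False using sum_degree[OF inst] k_pos[OF inst] m by simp
  qed
  have M: "2 ^ k \<le> M" "real (n + ?m) \<le> M" "real ?m \<le> M" by (simp_all add: M_def magnitude_def)
  have "2 ^ 1 \<le> (2::real) ^ k" by (rule power_increasing) (use k_pos[OF inst] in auto)
  then have M4: "4 \<le> M" using n m by (simp add: M_def magnitude_def)
  \<comment> \<open>Origin of the exponent \<open>a + 9\<close>: the inverse of \<open>p\<close> is
    at most \<open>M ^ 2 * M ^ 5 * M\<close>, for 12, \<open>24 ^ k\<close> and
    \<open>sqrt D'\<close>, while \<open>a\<close> is at most \<open>M ^ a\<close> and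
    \<open>n + m\<close> at most \<open>M\<close>.\<close>
  have "real a * real (n + ?m) \<le> p * T"
  proof -
    have "(24::real) ^ k \<le> 32 ^ k" by (rule power_mono) auto
    also have "\<dots> = (2 ^ k) ^ 5" by (simp add: power_mult[symmetric] mult.commute[of k] power_mult)
    also have "\<dots> \<le> M ^ 5" by (rule power_mono) (use M in auto)
    finally have e: "(24::real) ^ k \<le> M ^ 5" .
    have "sqrt D' \<le> D'" using \<open>1 \<le> D'\<close> by (intro real_le_lsqrt) (auto simp: power2_eq_square)
    also have "real D' \<le> M" using M(3) by (simp add: D'_def)
    finally have d: "sqrt D' \<le> M" .
    have "(12::real) \<le> 4 ^ 2" by simp
    also have "\<dots> \<le> M ^ 2" using M4 by (intro power_mono) auto
    finally have c: "12 \<le> M ^ 2" .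
    have "real a \<le> 2 ^ a" using less_exp[of a] by (metis less_imp_le of_nat_le_iff of_nat_numeral of_nat_power)
    also have "\<dots> \<le> M ^ a" using M4 by (intro power_mono) auto
    finally have b: "real a \<le> M ^ a" .
    have "12 * 24 ^ k * sqrt D' * (real a * real (n + ?m)) \<le> M ^ 2 * M ^ 5 * M * (M ^ a * M)"
      by (intro mult_mono b c d e M(2)) (use M4 in auto)
    also have "\<dots> = M ^ a * M ^ 9" by (simp add: eval_nat_numeral)
    also have "\<dots> = T" by (simp add: T_def M_def power_add)
    finally show ?thesis using \<open>1 \<le> D'\<close> by (simp add: p_def field_simps)
  qed
  \<comment> \<open>With \<open>p * T\<close> at least \<open>a * (n + m)\<close>, rather than a
    logarithmic amount, the bound \<open>exp x >= x\<close> already yields failure probability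
    \<open>1 / (n + m) ^ a\<close>.\<close>
  have "(1 - p) ^ T \<le> exp (- p) ^ T"
    by (rule power_mono) (use p1 exp_ge_add_one_self[of "- p"] in auto)
  also have "\<dots> = exp (- (p * T))" by (simp add: exp_of_nat_mult[symmetric] mult.commute)
  also have "\<dots> \<le> exp (- (real a * real (n + ?m)))" using \<open>_ \<le> p * T\<close> by simp
  also have "\<dots> = 1 / exp (real (n + ?m)) ^ a"
    by (simp only: exp_minus exp_of_nat_mult inverse_eq_divide)
  also have "\<dots> \<le> 1 / real (n + ?m) ^ a"
  proof (intro divide_left_mono power_mono)
    show "real (n + ?m) \<le> exp (real (n + ?m))" using exp_ge_add_one_self[of "real (n + ?m)"] by linarith
    show "0 < exp (real (n + ?m)) ^ a * real (n + ?m) ^ a" using n by simp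
  qed auto
  finally have "(1 - p) ^ T \<le> 1 / real (n + ?m) ^ a" .
  with fail have "1 - 1 / real (n + ?m) ^ a \<le>
      1 - avg (T * L + E) (\<lambda>bs. of_bool (\<forall>t<T. \<not> ok (\<lambda>i. bs ! (t * L + i))))" by linarith
  also have "\<dots> = avg (T * L + E) (\<lambda>bs. 1 - of_bool (\<forall>t<T. \<not> ok (\<lambda>i. bs ! (t * L + i))))"
    by (simp add: avg_diff)
  also have "\<dots> \<le> avg (T * L + E) (\<lambda>bs. of_bool (\<exists>t<T.
      advantage k / sqrt D \<le> \<bar>val I (improved n k I (\<lambda>i. bs ! (t * L + i))) - 1 / 2\<bar>))"
  proof (rule avg_mono)
    have "advantage k / sqrt D \<le> advantage k / sqrt D'"
    proof (rule divide_left_mono)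
      have D: "0 < D'" "D' \<le> D" using \<open>1 \<le> D'\<close> by (auto simp: D'_def)
      then show "sqrt (real D') \<le> sqrt (real D)" by simp
      show "0 < sqrt (real D) * sqrt (real D')" using D by simp
    qed (simp add: advantage_def)
    then have "ok r \<Longrightarrow> advantage k / sqrt D \<le> \<bar>val I (improved n k I r) - 1 / 2\<bar>" for r
      by (simp add: ok_def)
    then show "1 - of_bool (\<forall>t<T. \<not> ok (\<lambda>i. bs ! (t * L + i))) \<le> (of_bool (\<exists>t<T.
      advantage k / sqrt D \<le> \<bar>val I (improved n k I (\<lambda>i. bs ! (t * L + i))) - 1 / 2\<bar>) :: real)" for bs
      by auto
  qed
  finally show ?thesis .
qed

end

section \<open>Total correctness of deterministic programs\<close>

text \<open>The outcome must be a point mass, which expresses termination and determinism at once;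
  the postcondition also sees the running time.\<close>

definition wp :: "com \<Rightarrow> store \<Rightarrow> (store \<Rightarrow> nat \<Rightarrow> bool) \<Rightarrow> bool" where
  "wp c s Q \<longleftrightarrow> (\<exists>s' t. exec c s = return_spmf (s', t) \<and> Q s' t)"

lemma wp_conseq: "wp c s Q \<Longrightarrow> (\<And>s' t. Q s' t \<Longrightarrow> Q' s' t) \<Longrightarrow> wp c s Q'"
  by (auto simp: wp_def)

lemma wp_Skip: "Q s 1 \<Longrightarrow> wp Skip s Q"
  by (simp add: wp_def)

lemma wp_Assign: "Q (put v (aval i s) (aval a s) s) 1 \<Longrightarrow> wp (Assign v i a) s Q"
  by (simp add: wp_def)

lemma wp_Seq: "wp c1 s (\<lambda>s1 t1. wp c2 s1 (\<lambda>s2 t2. Q s2 (t1 + t2))) \<Longrightarrow> wp (Seq c1 c2) s Q"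
  by (auto simp: wp_def)

lemma wp_Cond:
  assumes "bval b s \<Longrightarrow> wp c1 s (\<lambda>s' t. Q s' (1 + t))" "\<not> bval b s \<Longrightarrow> wp c2 s (\<lambda>s' t. Q s' (1 + t))"
  shows "wp (Cond b c1 c2) s Q"
  using assms by (cases "bval b s") (auto simp: wp_def)

lemma wp_While:
  assumes init: "Inv a s" "a \<le> N"
    and step: "\<And>i s. a \<le> i \<Longrightarrow> i < N \<Longrightarrow> Inv i s \<Longrightarrow>
      bval b s \<and> wp c s (\<lambda>s' t. Inv (Suc i) s' \<and> t \<le> B)"
    and stop: "\<And>s. Inv N s \<Longrightarrow> \<not> bval b s"
  shows "wp (While b c) s (\<lambda>s' t. Inv N s' \<and> t \<le> (N - a) * (B + 1) + 1)"
proof -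
  have "wp (While b c) s (\<lambda>s' t. Inv N s' \<and> t \<le> d * (B + 1) + 1)"
    if "d = N - i" "a \<le> i" "i \<le> N" "Inv i s" for i d s
    using that
  proof (induction d arbitrary: i s)
    case 0
    then have "\<not> bval b s" using stop by simp
    then show ?case using 0 by (simp add: wp_def loop.simps)
  next
    case (Suc d)
    then have i: "i < N" by simp
    obtain s1 t1 where 1: "bval b s" "exec c s = return_spmf (s1, t1)" "Inv (Suc i) s1" "t1 \<le> B"
      using step[OF Suc.prems(2) i Suc.prems(4)] by (auto simp: wp_def)
    have "wp (While b c) s1 (\<lambda>s' t. Inv N s' \<and> t \<le> d * (B + 1) + 1)"
      by (rule Suc.IH[of "Suc i"]) (use Suc.prems i 1 in auto)
    then obtain s2 t2 where 2: "loop (bval b) (exec c) s1 = return_spmf (s2, t2)" "Inv N s2" "t2 \<le> d * (B + 1) + 1"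
      by (auto simp: wp_def)
    have "loop (bval b) (exec c) s = return_spmf (s2, 1 + t1 + t2)"
      by (subst loop.simps) (simp add: 1 2)
    then show ?case using 1 2 by (simp add: wp_def)
  qed
  from this[OF refl order_refl init(2,1)] show ?thesis .
qed

abbreviation V :: "string \<Rightarrow> aexp" where
  "V v \<equiv> Get v (Const 0)"

abbreviation assign :: "string \<Rightarrow> aexp \<Rightarrow> com" (infix "::=" 61) where
  "v ::= a \<equiv> Assign v (Const 0) a"

abbreviation seq :: "com \<Rightarrow> com \<Rightarrow> com" (infixr ";;" 60) where
  "c1 ;; c2 \<equiv> Seq c1 c2"

definition count :: "string \<Rightarrow> aexp \<Rightarrow> aexp \<Rightarrow> com \<Rightarrow> com" where
  "count v lo hi c = (v ::= lo ;; While (Less (V v) hi) (c ;; v ::= Plus (V v) (Const 1)))"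

lemma put_apply [simp]: "put v i c s w j = (if w = v \<and> j = i then c else s w j)"
  by (simp add: put_def)

text \<open>An iteration costs the body, the increment and the test, hence \<open>B + 2\<close>; the
  final 2 pays for the initialisation and the failing test. The assumption on \<open>hi\<close>
  keeps the loop bound fixed although it is evaluated again at each test.\<close>

lemma wp_count:
  assumes lo: "aval lo s = int a" "a \<le> N"
    and init: "Inv a (put v 0 (int a) s)"
    and hi: "\<And>i s. Inv i s \<Longrightarrow> s v 0 = int i \<Longrightarrow> aval hi s = int N"
    and step: "\<And>i s. a \<le> i \<Longrightarrow> i < N \<Longrightarrow> Inv i s \<Longrightarrow> s v 0 = int i \<Longrightarrow>
      wp c s (\<lambda>s' t. s' v 0 = int i \<and> Inv (Suc i) (put v 0 (int (Suc i)) s') \<and> t \<le> B)"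
  shows "wp (count v lo hi c) s (\<lambda>s' t. Inv N s' \<and> s' v 0 = int N \<and> t \<le> (N - a) * (B + 2) + 2)"
  unfolding count_def
proof (rule wp_Seq, rule wp_Assign)
  let ?J = "\<lambda>i s. Inv i s \<and> s v 0 = int i"
  let ?w = "While (Less (V v) hi) (c ;; v ::= Plus (V v) (Const 1))"
  have "wp ?w (put v 0 (int a) s) (\<lambda>s' t. ?J N s' \<and> t \<le> (N - a) * (Suc B + 1) + 1)"
  proof (rule wp_While)
    show "Inv a (put v 0 (int a) s) \<and> put v 0 (int a) s v 0 = int a" using init by simp
    fix i s assume i: "a \<le> i" "i < N" "?J i s"
    have "wp (c ;; v ::= Plus (V v) (Const 1)) s (\<lambda>s' t. ?J (Suc i) s' \<and> t \<le> Suc B)"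
      by (intro wp_Seq wp_conseq[OF step[of i s]] wp_Assign)
        (use i in \<open>auto simp: add.commute\<close>)
    then show "bval (Less (V v) hi) s \<and>
        wp (c ;; v ::= Plus (V v) (Const 1)) s (\<lambda>s' t. ?J (Suc i) s' \<and> t \<le> Suc B)"
      using hi[of i s] i by simp
  next
    fix s assume "?J N s"
    then show "\<not> bval (Less (V v) hi) s" using hi[of N s] by simp
  qed (rule lo)
  then show "wp ?w (put v (aval (Const 0) s) (aval lo s) s)
     (\<lambda>s2 t2. Inv N s2 \<and> s2 v 0 = int N \<and> 1 + t2 \<le> (N - a) * (B + 2) + 2)"
    unfolding lo(1) aval.simps(1) by (rule wp_conseq) auto
qed

text \<open>Frame condition: \<open>X\<close> lists the arrays that may have changed.\<close>

definition agree :: "string set \<Rightarrow> store \<Rightarrow> store \<Rightarrow> bool" where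
  "agree X s' s \<longleftrightarrow> (\<forall>v. v \<notin> X \<longrightarrow> s' v = s v)"

lemma agree_refl [simp]: "agree X s s"
  by (simp add: agree_def)

lemma agree_put [simp]: "v \<in> X \<Longrightarrow> agree X (put v i c s') s = agree X s' s"
  by (auto simp: agree_def put_def)

lemma agreeD: "agree X s' s \<Longrightarrow> v \<notin> X \<Longrightarrow> s' v = s v"
  by (simp add: agree_def)

lemma agree_trans: "agree X s2 s1 \<Longrightarrow> agree Y s1 s \<Longrightarrow> X \<subseteq> Z \<Longrightarrow> Y \<subseteq> Z \<Longrightarrow> agree Z s2 s"
  by (metis agree_def subsetD)

text \<open>Horner's rule with doubling by addition. Advancing \<open>p\<close> past the bits makes
  successive calls read disjoint blocks.\<close>

definition readnum :: "string \<Rightarrow> com" where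
  "readnum d =
    (d ::= Const 0 ;;
     count ''i'' (Const 0) (V ''k'') (d ::= Plus (Plus (V d) (V d)) (Get ''r'' (Plus (V ''p'') (V ''i'')))) ;;
     ''p'' ::= Plus (V ''p'') (V ''k''))"

lemma wp_readnum:
  assumes "s ''k'' 0 = int k" "s ''p'' 0 = int p"
    and r: "\<And>i. i < k \<Longrightarrow> s ''r'' (int (p + i)) = of_bool (\<rho> (p + i))"
    and d: "''k'' \<noteq> d" "''p'' \<noteq> d" "''r'' \<noteq> d" "''i'' \<noteq> d"
  shows "wp (readnum d) s (\<lambda>s' t. agree {d, ''i'', ''p''} s' s \<and> s' d 0 = int (bit_num \<rho> p k) \<and>
    s' ''p'' 0 = int (p + k) \<and> t \<le> 3 * k + 4)"
  unfolding readnum_def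
  apply (rule wp_Seq, rule wp_Assign, rule wp_Seq)
  apply (rule wp_conseq[OF wp_count[where a = 0 and N = k and B = 1 and
      Inv = "\<lambda>i s'. agree {d, ''i''} s' s \<and> s' d 0 = int (bit_num \<rho> p i)"]])
       apply simp
      apply simp
     apply (use d d[symmetric] in simp)
    apply (use assms d d[symmetric] in \<open>auto dest!: agreeD[where v = "''k''"]\<close>)[]
   apply (rule wp_Assign)
  subgoal for i s'
    using assms(2) r[of i] d d[symmetric] agreeD[of "{d, ''i''}" s' s "''p''"] agreeD[of "{d, ''i''}" s' s "''r''"]
    by simp
  apply (rule wp_Assign)
  subgoal for s' t
    using assms(1,2) d d[symmetric] agreeD[of "{d, ''i''}" s' s "''p''"] agreeD[of "{d, ''i''}" s' s "''k''"]
    by (auto intro: agree_trans)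
  done

section \<open>Evaluating an assignment\<close>

lemma put_other [simp]: "w \<noteq> v \<Longrightarrow> put v i c s w = s w"
  by (simp add: put_def)

text \<open>Multiplication by a sign is done by conditional negation, since the machine cannot
  multiply. The offset \<open>o\<close> addresses the first scope cell of the current
  constraint.\<close>

definition signs :: com where
  "signs = count ''i'' (Const 0) (V ''k'')
     (Cond (Less (Get ''y'' (Get ''scope'' (Plus (V ''o'') (V ''i'')))) (Const 0))
        (''c'' ::= Minus (Const 0) (V ''c'')) Skip)"

definition spread :: com where
  "spread = count ''i'' (Const 0) (V ''k'')
     (Assign ''H'' (Get ''scope'' (Plus (V ''o'') (V ''i'')))
        (Plus (Get ''H'' (Get ''scope'' (Plus (V ''o'') (V ''i'')))) (V ''c'')))"

definition evaluate :: com where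
  "evaluate =
    (count ''j'' (Const 1) (Plus (V ''n'') (Const 1)) (Assign ''H'' (V ''j'') (Const 0)) ;;
     ''B'' ::= Const 0 ;;
     ''o'' ::= Const 0 ;;
     count ''l'' (Const 0) (V ''m'')
       (''c'' ::= Get ''sign'' (V ''l'') ;;
        signs ;;
        spread ;;
        ''B'' ::= Plus (V ''B'') (V ''c'') ;;
        ''o'' ::= Plus (V ''o'') (V ''k'')))"

lemma wp_signs:
  assumes s: "s ''k'' 0 = int (length js)" "s ''o'' 0 = int q"
    and js: "\<And>i. i < length js \<Longrightarrow> s ''scope'' (int (q + i)) = int (js ! i)"
    and y: "\<And>j. j \<in> set js \<Longrightarrow> s ''y'' (int j) \<in> {1, -1}"
  shows "wp signs s (\<lambda>s' t. agree {''i'', ''c''} s' s \<and>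
    s' ''c'' 0 = s ''c'' 0 * (\<Prod>j\<leftarrow>js. s ''y'' (int j)) \<and> t \<le> 4 * length js + 2)"
  unfolding signs_def
  apply (rule wp_conseq[OF wp_count[where a = 0 and N = "length js" and B = 2 and
      Inv = "\<lambda>i s'. agree {''i'', ''c''} s' s \<and>
        s' ''c'' 0 = s ''c'' 0 * (\<Prod>j\<leftarrow>take i js. s ''y'' (int j))"]])
       apply simp
      apply simp
     apply simp
    apply (simp add: agree_def s)
   apply (rule wp_Cond)
  subgoal for i s'
    using js[of i] s(2) y[of "js ! i"]
    by (intro wp_Assign) (simp add: agree_def take_Suc_conv_app_nth)
  subgoal for i s'
    using js[of i] s(2) y[of "js ! i"]
    by (intro wp_Skip) (auto simp: agree_def take_Suc_conv_app_nth)
  apply simp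
  done

lemma nth_notin_take: "distinct xs \<Longrightarrow> i < length xs \<Longrightarrow> xs ! i \<notin> set (take i xs)"
  by (metis distinct_append distinct_take take_Suc_conv_app_nth disjoint_insert(1) list.set_intros(1) not_distinct_conv_prefix)

lemma wp_spread:
  assumes s: "s ''k'' 0 = int (length js)" "s ''o'' 0 = int q"
    and js: "\<And>i. i < length js \<Longrightarrow> s ''scope'' (int (q + i)) = int (js ! i)" "distinct js"
  shows "wp spread s (\<lambda>s' t. agree {''i'', ''H''} s' s \<and>
    (\<forall>j. s' ''H'' (int j) = s ''H'' (int j) + (if j \<in> set js then s ''c'' 0 else 0)) \<and>
    t \<le> 3 * length js + 2)"
  unfolding spread_def
  apply (rule wp_conseq[OF wp_count[where a = 0 and N = "length js" and B = 1 and
      Inv = "\<lambda>i s'. agree {''i'', ''H''} s' s \<and>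
        (\<forall>j. s' ''H'' (int j) = s ''H'' (int j) + (if j \<in> set (take i js) then s ''c'' 0 else 0))"]])
       apply simp
      apply simp
     apply simp
    apply (simp add: agree_def s)
   apply (rule wp_Assign)
  subgoal for i s'
    using js(1)[of i] s(2) nth_notin_take[OF js(2), of i]
    by (simp add: agree_def take_Suc_conv_app_nth)
  apply simp
  done

text \<open>The part of the input encoding that the program reads, stated as a property so that it
  survives writes to the work arrays.\<close>

definition loaded :: "nat \<Rightarrow> nat \<Rightarrow> xor_constraint list \<Rightarrow> store \<Rightarrow> bool" where
  "loaded n k I s \<longleftrightarrow>
     s ''n'' 0 = int n \<and> s ''m'' 0 = int (length I) \<and> s ''k'' 0 = int k \<and>
     (\<forall>l<length I. s ''sign'' (int l) = snd (I ! l)) \<and>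
     (\<forall>l<length I. \<forall>i<k. s ''scope'' (int (l * k + i)) = int (sorted_list_of_set (fst (I ! l)) ! i))"

lemma loaded_agree:
  "agree X s' s \<Longrightarrow> X \<inter> {''n'', ''m'', ''k'', ''sign'', ''scope''} = {} \<Longrightarrow>
    loaded n k I s' = loaded n k I s"
  by (auto simp: loaded_def agree_def)

context
  fixes n k :: nat and I :: "xor_constraint list"
  assumes inst: "max_kxor n k I"
begin

lemma wp_evaluate:
  assumes s: "loaded n k I s" and y: "\<And>j. j \<in> {1..n} \<Longrightarrow> s ''y'' (int j) = f j"
    and f: "assignment n f"
  shows "wp evaluate s (\<lambda>s' t. agree {''i'', ''j'', ''l'', ''c'', ''o'', ''B'', ''H''} s' s \<and>
    s' ''B'' 0 = bias I f \<and> (\<forall>j\<in>{1..n}. s' ''H'' (int j) = local_bias I f j) \<and>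
    t \<le> 3 * n + 6 + length I * (7 * k + 9))"
proof -
  \<comment> \<open>The local bias of \<open>j\<close> restricted to the first \<open>l\<close>
    constraints.\<close>
  let ?h = "\<lambda>l j. \<Sum>l'<l. if j \<in> fst (I ! l') then cval f (I ! l') else 0"
  let ?Inv = "\<lambda>l s'. agree {''i'', ''j'', ''l'', ''c'', ''o'', ''B'', ''H''} s' s \<and>
    s' ''B'' 0 = (\<Sum>l'<l. cval f (I ! l')) \<and> (\<forall>j\<in>{1..n}. s' ''H'' (int j) = ?h l j) \<and>
    s' ''o'' 0 = int (l * k)"
  have nm: "s ''n'' 0 = int n" "s ''m'' 0 = int (length I)" "s ''k'' 0 = int k"
    using s by (auto simp: loaded_def)
  have h_local_bias: "?h (length I) j = local_bias I f j" for j
    unfolding local_bias_def using sum.inter_filter[of "{..<length I}" "\<lambda>l. cval f (I ! l)" "\<lambda>l. j \<in> fst (I ! l)"]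
    by simp
  \<comment> \<open>The bound \<open>7 * k + 7\<close> adds \<open>4 * k + 2\<close> for
    \<open>signs\<close>, \<open>3 * k + 2\<close> for \<open>spread\<close> and three
    assignments.\<close>
  have step: "wp (''c'' ::= Get ''sign'' (V ''l'') ;; signs ;; spread ;;
      ''B'' ::= Plus (V ''B'') (V ''c'') ;; ''o'' ::= Plus (V ''o'') (V ''k'')) s1
      (\<lambda>s' t. s' ''l'' 0 = int l \<and> ?Inv (Suc l) (put ''l'' 0 (int (Suc l)) s') \<and> t \<le> 7 * k + 7)"
    if l: "l < length I" and inv: "?Inv l s1" and sl: "s1 ''l'' 0 = int l" for l s1
  proof -
    define js where "js = sorted_list_of_set (fst (I ! l))"
    have js: "set js = fst (I ! l)" "distinct js" "length js = k"
      using scope[OF inst l] by (auto simp: js_def)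
    have ld: "s1 ''k'' 0 = int k" "s1 ''sign'' (int l) = snd (I ! l)"
      "\<And>i. i < k \<Longrightarrow> s1 ''scope'' (int (l * k + i)) = int (js ! i)"
      "\<And>j. s1 ''y'' j = s ''y'' j"
      using s l inv by (auto simp: loaded_def agree_def js_def)
    have sub: "set js \<subseteq> {1..n}" using js(1) scope(1)[OF inst l] by simp
    have prod: "snd (I ! l) * (\<Prod>j\<leftarrow>js. s ''y'' (int j)) = cval f (I ! l)"
    proof -
      have "(\<Prod>j\<leftarrow>js. s ''y'' (int j)) = (\<Prod>j\<in>set js. s ''y'' (int j))"
        by (rule prod.distinct_set_conv_list[OF js(2), symmetric])
      also have "\<dots> = (\<Prod>j\<in>fst (I ! l). f j)"
        unfolding js(1)[symmetric] by (rule prod.cong) (use sub y in auto)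
      finally show ?thesis by (simp add: cval_def)
    qed
    show ?thesis
      apply (rule wp_Seq, rule wp_Assign, rule wp_Seq)
      apply (rule wp_conseq[OF wp_signs[where js = js and q = "l * k"]])
          apply (simp add: ld js)
         apply (use inv in simp)
        apply (use ld js in simp)
      subgoal for j
        using subsetD[OF sub, of j] y[of j] f by (auto simp: ld assignment_def)
      subgoal for s2 t2
        apply (rule wp_Seq)
        apply (rule wp_conseq[OF wp_spread[where js = js and q = "l * k"]])
            apply (use ld js in \<open>simp add: agree_def\<close>)
           apply (use inv in \<open>simp add: agree_def\<close>)
          apply (use ld js in \<open>simp add: agree_def\<close>)
         apply (rule js)
        apply (rule wp_Seq, rule wp_Assign, rule wp_Assign)
        using inv ld(1,2) sl prod js(3) by (simp add: agree_def js(1))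
      done
  qed
  show ?thesis
    unfolding evaluate_def
    apply (rule wp_Seq)
    apply (rule wp_conseq[OF wp_count[where a = 1 and N = "n + 1" and B = 1 and
      Inv = "\<lambda>i s'. agree {''j'', ''H''} s' s \<and> (\<forall>j\<in>{1..<i}. s' ''H'' (int j) = 0)"]])
         apply simp
        apply simp
       apply simp
      apply (simp add: agree_def nm)
     apply (rule wp_Assign)
     apply (auto simp: less_Suc_eq)[]
    subgoal for s1 t1
      apply (rule wp_Seq, rule wp_Assign, rule wp_Seq, rule wp_Assign)
      apply (rule wp_conseq[OF wp_count[where a = 0 and N = "length I" and B = "7 * k + 7" and Inv = ?Inv]])
           apply simp
          apply simp
         apply (simp add: agree_def)
        apply (simp add: agree_def nm)
       apply (rule step; assumption)
      apply (simp add: h_local_bias bias_def algebra_simps)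
      done
    done
qed

end

section \<open>One trial\<close>

definition init_y :: com where
  "init_y = count ''j'' (Const 1) (Plus (V ''n'') (Const 1))
     (Cond (Less (Const 0) (Get ''r'' (Minus (Plus (V ''p'') (V ''j'')) (Const 1))))
        (Assign ''y'' (V ''j'') (Const 1)) (Assign ''y'' (V ''j'') (Const (-1))))"

text \<open>The comparison number is read even when \<open>H\<close> is nonnegative, so the block of
  variable \<open>j\<close> starts at a fixed position, as in \<open>improved\<close>.
  \<open>H\<close> is not updated in between: all decisions refer to the initial signs.\<close>

definition flip_some :: com where
  "flip_some = count ''j'' (Const 1) (Plus (V ''n'') (Const 1))
     (readnum ''U'' ;;
      Cond (Conj (Less (V ''U'') (V ''R'')) (Less (Get ''H'' (V ''j'')) (Const 0)))
        (Assign ''y'' (V ''j'') (Minus (Const 0) (Get ''y'' (V ''j'')))) Skip)"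

text \<open>A negative bias is recorded through the negated assignment, which has bias
  \<open>(-1) ^ k * bias\<close>.\<close>

definition record_best :: com where
  "record_best =
    (Cond (Less (V ''B'') (Const 0)) (''A'' ::= Minus (Const 0) (V ''B'')) (''A'' ::= V ''B'') ;;
     Cond (Less (V ''best'') (V ''A''))
       (''best'' ::= V ''A'' ;;
        count ''j'' (Const 1) (Plus (V ''n'') (Const 1))
          (Cond (Less (V ''B'') (Const 0))
             (Assign ''x'' (V ''j'') (Minus (Const 0) (Get ''y'' (V ''j''))))
             (Assign ''x'' (V ''j'') (Get ''y'' (V ''j'')))))
       Skip)"

text \<open>The first \<open>evaluate\<close> supplies the local biases of the initial signs, the
  second the bias of the improved assignment.\<close>

definition trial :: com where
  "trial =
    (init_y ;; ''p'' ::= Plus (V ''p'') (V ''n'') ;; readnum ''R'' ;; evaluate ;; flip_some ;;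
     evaluate ;; record_best)"

lemma wp_init_y:
  assumes s: "s ''n'' 0 = int n" "s ''p'' 0 = int p"
    and r: "\<And>i. i < n \<Longrightarrow> s ''r'' (int (p + i)) = of_bool (\<rho> (p + i))"
  shows "wp init_y s (\<lambda>s' t. agree {''j'', ''y''} s' s \<and>
    (\<forall>j\<in>{1..n}. s' ''y'' (int j) = start (\<lambda>i. \<rho> (p + i)) j) \<and> t \<le> 4 * n + 2)"
proof -
  have r': "s ''r'' (int p + int j - 1) = of_bool (\<rho> (p + (j - 1)))" if "1 \<le> j" "j < n + 1" for j
    using r[of "j - 1"] that by (simp add: algebra_simps of_nat_diff)
  show ?thesis
    unfolding init_y_def
    apply (rule wp_conseq[OF wp_count[where a = 1 and N = "n + 1" and B = 2 and
      Inv = "\<lambda>i s'. agree {''j'', ''y''} s' s \<and>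
        (\<forall>j\<in>{1..<i}. s' ''y'' (int j) = start (\<lambda>i. \<rho> (p + i)) j)"]])
         apply simp
        apply simp
       apply simp
      apply (simp add: agree_def s)
    subgoal for i s'
      using r'[of i] s
      by (intro wp_Cond wp_Assign) (simp_all add: agree_def start_def sg_def atLeastLessThanSuc)
    apply (simp add: atLeastLessThanSuc_atLeastAtMost)
    done
qed

lemma wp_flip_some:
  assumes s: "s ''n'' 0 = int n" "s ''k'' 0 = int k" "s ''p'' 0 = int p" "s ''R'' 0 = int v"
    and r: "\<And>i. i < n * k \<Longrightarrow> s ''r'' (int (p + i)) = of_bool (\<rho> (p + i))"
    and yh: "\<And>j. j \<in> {1..n} \<Longrightarrow> s ''y'' (int j) = f j \<and> s ''H'' (int j) = h j"
  shows "wp flip_some s (\<lambda>s' t. agree {''i'', ''j'', ''y'', ''U'', ''p''} s' s \<and>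
    (\<forall>j\<in>{1..n}. s' ''y'' (int j) =
       (if bit_num \<rho> (p + (j - 1) * k) k < v \<and> h j < 0 then - f j else f j)) \<and>
    s' ''p'' 0 = int (p + n * k) \<and> t \<le> n * (3 * k + 8) + 2)"
proof -
  let ?g = "\<lambda>j. if bit_num \<rho> (p + (j - 1) * k) k < v \<and> h j < 0 then - f j else f j"
  let ?Inv = "\<lambda>i s'. agree {''i'', ''j'', ''y'', ''U'', ''p''} s' s \<and>
    (\<forall>j\<in>{1..<i}. s' ''y'' (int j) = ?g j) \<and> (\<forall>j\<in>{i..n}. s' ''y'' (int j) = f j) \<and>
    s' ''p'' 0 = int (p + (i - 1) * k)"
  have step: "wp (readnum ''U'' ;;
      Cond (Conj (Less (V ''U'') (V ''R'')) (Less (Get ''H'' (V ''j'')) (Const 0)))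
        (Assign ''y'' (V ''j'') (Minus (Const 0) (Get ''y'' (V ''j'')))) Skip) s1
      (\<lambda>s' t. s' ''j'' 0 = int i \<and> ?Inv (Suc i) (put ''j'' 0 (int (Suc i)) s') \<and> t \<le> 3 * k + 6)"
    if i: "1 \<le> i" "i < n + 1" and inv: "?Inv i s1" and si: "s1 ''j'' 0 = int i" for i s1
  proof -
    obtain i' where i': "i = Suc i'" using i by (cases i) auto
    have y: "s1 ''y'' (int i) = f i" "s ''H'' (int i) = h i" using inv i yh by auto
    have bits: "s1 ''r'' (int (p + (i - 1) * k + b)) = of_bool (\<rho> (p + (i - 1) * k + b))" if "b < k" for b
    proof -
      have "i' * k + b < i' * k + k" using that by simp
      also have "\<dots> = i * k" by (simp add: i')
      also have "\<dots> \<le> n * k" using i by (intro mult_le_mono1) simp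
      finally show ?thesis using r[of "i' * k + b"] inv by (simp add: agree_def i' add.assoc)
    qed
    show ?thesis
      apply (rule wp_Seq)
      apply (rule wp_conseq[OF wp_readnum[where k = k and p = "p + (i - 1) * k" and \<rho> = \<rho>]])
             apply (use inv s in \<open>simp add: agree_def\<close>)
            apply (use inv in simp)
           apply (rule bits, assumption)
          apply simp
         apply simp
        apply simp
       apply simp
      subgoal for s2 t2
        apply (rule wp_Cond)
        subgoal
          using inv i si s y
          by (intro wp_Assign) (simp_all add: agree_def i' atLeastLessThanSuc)
        subgoal
          using inv i si s y
          apply (intro wp_Skip)
          apply (simp add: agree_def i' atLeastLessThanSuc)
          apply blast
          done
        done
      done
  qed
  show ?thesis
    unfolding flip_some_def
    apply (rule wp_conseq[OF wp_count[where a = 1 and N = "n + 1" and B = "3 * k + 6" and Inv = ?Inv]])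
         apply simp
        apply simp
       apply (use s yh in simp)
      apply (simp add: agree_def s)
     apply (rule step; assumption)
    apply (simp add: atLeastLessThanSuc_atLeastAtMost add.commute)
    done
qed

lemma wp_record_best:
  assumes s: "s ''n'' 0 = int n" "s ''B'' 0 = b"
    and y: "\<And>j. j \<in> {1..n} \<Longrightarrow> s ''y'' (int j) = f j"
  shows "wp record_best s (\<lambda>s' t. agree {''j'', ''A'', ''best'', ''x''} s' s \<and>
    (if s ''best'' 0 < \<bar>b\<bar>
     then s' ''best'' 0 = \<bar>b\<bar> \<and> (\<forall>j\<in>{1..n}. s' ''x'' (int j) = (if b < 0 then - f j else f j))
     else s' ''best'' 0 = s ''best'' 0 \<and> s' ''x'' = s ''x'') \<and> t \<le> 4 * n + 6)"
  unfolding record_best_def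
  apply (rule wp_Seq)
  apply (rule wp_conseq[where Q = "\<lambda>s' t. agree {''A''} s' s \<and> s' ''A'' 0 = \<bar>b\<bar> \<and> t \<le> 2"])
   apply (intro wp_Cond wp_Assign; use s in simp)
  subgoal for s1 t1
    apply (rule wp_Cond)
    subgoal
      apply (rule wp_Seq, rule wp_Assign)
      apply (rule wp_conseq[OF wp_count[where a = 1 and N = "n + 1" and B = 2 and
        Inv = "\<lambda>i s'. agree {''j'', ''x'', ''best''} s' s1 \<and> s' ''best'' 0 = \<bar>b\<bar> \<and>
          (\<forall>j\<in>{1..<i}. s' ''x'' (int j) = (if b < 0 then - f j else f j))"]])
           apply simp
          apply simp
         apply simp
        apply (simp add: agree_def s)
      subgoal for i s'
        using y[of i] s
        by (intro wp_Cond wp_Assign) (simp_all add: agree_def atLeastLessThanSuc)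
      apply (simp add: agree_def atLeastLessThanSuc_atLeastAtMost)
      done
    subgoal by (rule wp_Skip) (simp add: agree_def)
    done
  done

context
  fixes n k :: nat and I :: "xor_constraint list"
  assumes inst: "max_kxor n k I"
begin

lemma wp_trial:
  fixes \<rho> :: "nat \<Rightarrow> bool" and p :: nat
  defines "w \<equiv> improved n k I (\<lambda>i. \<rho> (p + i))"
  assumes s: "loaded n k I s" "s ''p'' 0 = int p"
    and r: "\<And>i. i < n + k + n * k \<Longrightarrow> s ''r'' (int (p + i)) = of_bool (\<rho> (p + i))"
  shows "wp trial s (\<lambda>s' t.
    agree {''i'', ''j'', ''l'', ''c'', ''o'', ''B'', ''H'', ''y'', ''U'', ''R'', ''A'', ''p'', ''best'', ''x''} s' s \<and>
    s' ''p'' 0 = int (p + (n + k + n * k)) \<and>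
    (if s ''best'' 0 < \<bar>bias I w\<bar>
     then s' ''best'' 0 = \<bar>bias I w\<bar> \<and>
       (\<forall>j\<in>{1..n}. s' ''x'' (int j) = (if bias I w < 0 then - w j else w j))
     else s' ''best'' 0 = s ''best'' 0 \<and> s' ''x'' = s ''x'') \<and>
    t \<le> 3 * k * n + 22 * n + 3 * k + 30 + 2 * length I * (7 * k + 9))"
proof -
  define f where "f = start (\<lambda>i. \<rho> (p + i))"
  have f: "assignment n f" using sg_cases by (auto simp: f_def start_def assignment_def)
  have w: "assignment n w" unfolding w_def by (rule assignment_improved[OF inst])
  have bnp: "bit_num (\<lambda>i. \<rho> (p + i)) q k = bit_num \<rho> (p + q) k" for q
    by (rule bit_num_cong) (simp add: add.assoc)
  have w_eq: "w j = (if bit_num \<rho> (p + n + k + (j - 1) * k) k < bit_num \<rho> (p + n) k \<and> local_bias I f j < 0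
      then - f j else f j)" for j
    unfolding w_def improved_def bnp f_def by (simp add: add.assoc)
  have nk: "s ''n'' 0 = int n" "s ''k'' 0 = int k" using s(1) by (auto simp: loaded_def)
  have r1: "s ''r'' (int (p + n + i)) = of_bool (\<rho> (p + n + i))" if "i < k" for i
    using r[of "n + i"] that by (simp add: add.assoc)
  have r2: "s ''r'' (int (p + n + k + i)) = of_bool (\<rho> (p + n + k + i))" if "i < n * k" for i
    using r[of "n + k + i"] that by (simp add: add.assoc)
  show ?thesis
    unfolding trial_def
    apply (rule wp_Seq)
    apply (rule wp_conseq[OF wp_init_y[where n = n and p = p and \<rho> = \<rho>, folded f_def]])
       apply (rule nk)
      apply (rule s)
     apply (rule r, simp)
    apply (rule wp_Seq, rule wp_Assign, rule wp_Seq)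
    subgoal for s1 t1
      apply (rule wp_conseq[OF wp_readnum[where k = k and p = "p + n" and \<rho> = \<rho>]])
             apply (simp add: agree_def nk)
            apply (simp add: agree_def nk s)
           apply (use r1 in \<open>simp add: agree_def\<close>)
          apply simp
         apply simp
        apply simp
       apply simp
      apply (rule wp_Seq)
      subgoal for s2 t2
        apply (rule wp_conseq[OF wp_evaluate[OF inst, where f = f]])
           apply (subst loaded_agree[where s = s and X = "{''j'', ''y'', ''p'', ''R'', ''i''}"])
             apply (auto simp: agree_def)[]
            apply simp
           apply (rule s)
          apply (simp add: agree_def)
         apply (rule f)
        apply (rule wp_Seq)
        subgoal for s3 t3
          apply (rule wp_conseq[OF wp_flip_some[where n = n and k = k and p = "p + n + k" and
              v = "bit_num \<rho> (p + n) k" and \<rho> = \<rho> and f = f and h = "local_bias I f"]])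
                apply (simp add: agree_def nk)
               apply (simp add: agree_def nk)
              apply (simp add: agree_def)
             apply (simp add: agree_def)
            apply (use r2 in \<open>simp add: agree_def\<close>)
           apply (simp add: agree_def)
          apply (rule wp_Seq)
          subgoal for s4 t4
            apply (rule wp_conseq[OF wp_evaluate[OF inst, where f = w]])
               apply (subst loaded_agree[where s = s and
                   X = "{''i'', ''j'', ''l'', ''c'', ''o'', ''B'', ''H'', ''y'', ''U'', ''R'', ''p''}"])
                 apply (simp add: agree_def)
                apply simp
               apply (rule s)
              apply (simp add: w_eq)
             apply (rule w)
            subgoal for s5 t5
              apply (rule wp_conseq[OF wp_record_best[where n = n and b = "bias I w" and f = w]])
                 apply (simp add: agree_def nk)
                apply simp
               apply (simp add: agree_def w_eq)
              apply (simp add: agree_def algebra_simps split: if_split_asm)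
              done
            done
          done
        done
      done
    done
qed

end

section \<open>The randomized program\<close>

primrec coins :: "nat \<Rightarrow> bool list spmf" where
  "coins 0 = return_spmf []"
| "coins (Suc d) = bind_spmf coin_spmf (\<lambda>b. map_spmf (Cons b) (coins d))"

lemma lossless_coins [simp]: "lossless_spmf (coins d)"
  by (induction d) auto

lemma length_coins: "xs \<in> set_spmf (coins d) \<Longrightarrow> length xs = d"
  by (induction d arbitrary: xs) (auto simp: set_bind_spmf)

text \<open>Bridge from the program semantics to \<open>avg\<close>; both recursions split off the
  first coin.\<close>

lemma measure_coins: "measure (measure_spmf (coins d)) {xs. P xs} = avg d (\<lambda>xs. of_bool (P xs))"
proof (induction d arbitrary: P)
  case (Suc d)
  have "measure (measure_spmf (coins (Suc d))) {xs. P xs} =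
      integral\<^sup>L (measure_spmf coin_spmf) (\<lambda>b. measure (measure_spmf (map_spmf (Cons b) (coins d))) {xs. P xs})"
    by (simp add: measure_spmf_bind o_def measure_spmf.measure_bind[where N="count_space UNIV"])
  also have "\<dots> = (\<Sum>b\<in>UNIV. measure (measure_spmf (coins d)) {xs. P (b # xs)}) / 2"
    by (simp add: integral_spmf_of_set measure_map_spmf vimage_def)
  also have "\<dots> = avg (Suc d) (\<lambda>xs. of_bool (P xs))"
    by (simp add: UNIV_bool Suc.IH)
  finally show ?case .
qed (simp add: measure_spmf_return_spmf measure_return indicator_def)

definition flips :: com where
  "flips = While (Less (V ''i'') (V ''N'')) (Flip ''r'' (V ''i'') ;; ''i'' ::= Plus (V ''i'') (Const 1))"

primrec fill :: "store \<Rightarrow> bool list \<Rightarrow> store" where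
  "fill s [] = s"
| "fill s (b # bs) = fill (put ''i'' 0 (s ''i'' 0 + 1) (put ''r'' (s ''i'' 0) (of_bool b) s)) bs"

text \<open>The number of iterations is fixed in advance, so the loop unfolds by induction on it and
  its running time is the same for all outcomes.\<close>

lemma exec_flips:
  "s ''N'' 0 = s ''i'' 0 + int d \<Longrightarrow> exec flips s = map_spmf (\<lambda>bs. (fill s bs, 3 * d + 1)) (coins d)"
proof (induction d arbitrary: s)
  case 0
  then show ?case by (simp add: flips_def loop.simps)
next
  case (Suc d)
  define s' where "s' b = put ''i'' 0 (s ''i'' 0 + 1) (put ''r'' (s ''i'' 0) (of_bool b) s)" for b
  have IH: "loop (bval (Less (V ''i'') (V ''N''))) (exec (Flip ''r'' (V ''i'') ;; ''i'' ::= Plus (V ''i'') (Const 1))) (s' b) =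
      map_spmf (\<lambda>bs. (fill (s' b) bs, 3 * d + 1)) (coins d)" for b
  proof -
    have "s' b ''N'' 0 = s' b ''i'' 0 + int d" using Suc.prems by (simp add: s'_def)
    from Suc.IH[of "s' b", OF this] show ?thesis unfolding flips_def exec.simps(6) .
  qed
  have body: "exec (Flip ''r'' (V ''i'') ;; ''i'' ::= Plus (V ''i'') (Const 1)) s =
      map_spmf (\<lambda>b. (s' b, 2)) coin_spmf"
    by (simp add: s'_def bind_map_spmf o_def map_spmf_conv_bind_spmf of_bool_def numeral_2_eq_2)
  have four: "Suc (Suc (Suc (Suc x))) = 4 + x" for x by simp
  have "exec flips s = bind_spmf coin_spmf (\<lambda>b. map_spmf (\<lambda>bs. (fill (s' b) bs, 3 * Suc d + 1)) (coins d))"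
    unfolding flips_def exec.simps(6)
    apply (subst loop.simps)
    apply (simp only: body bind_map_spmf o_def case_prod_conv IH)
    apply (use Suc.prems in \<open>simp add: map_spmf_conv_bind_spmf four\<close>)
    done
  also have "\<dots> = map_spmf (\<lambda>bs. (fill s bs, 3 * Suc d + 1)) (coins (Suc d))"
    by (simp add: map_spmf_bind_spmf o_def spmf.map_comp s'_def)
  finally show ?case .
qed

lemma agree_fill: "agree {''i'', ''r''} (fill s bs) s"
proof (induction bs arbitrary: s)
  case (Cons b bs)
  show ?case
    unfolding fill.simps by (rule agree_trans[OF Cons, where Y = "{''i'', ''r''}"])
      (simp_all only: agree_put agree_refl insertI1 insertI2 subset_refl)
qed simp

lemma fill_r:
  "s ''i'' 0 = int q \<Longrightarrow> fill s bs ''r'' (int i) =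
    (if q \<le> i \<and> i < q + length bs then of_bool (bs ! (i - q)) else s ''r'' (int i))"
proof (induction bs arbitrary: s q)
  case (Cons b bs)
  define v :: int where "v = of_bool b"
  define s2 where "s2 = put ''i'' 0 (s ''i'' 0 + 1) (put ''r'' (s ''i'' 0) v s)"
  have s2: "s2 ''i'' 0 = int (Suc q)" "s2 ''r'' (int i) = (if i = q then v else s ''r'' (int i))"
    using Cons.prems by (simp_all add: s2_def)
  have "fill s (b # bs) ''r'' (int i) = fill s2 bs ''r'' (int i)"
    by (simp only: fill.simps s2_def v_def)
  also have "\<dots> =
     (if Suc q \<le> i \<and> i < Suc q + length bs then of_bool (bs ! (i - Suc q))
      else if i = q then v else s ''r'' (int i))"
    unfolding Cons.IH[of s2, OF s2(1)] s2(2) ..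
  also have "\<dots> = (if q \<le> i \<and> i < q + length (b # bs) then of_bool ((b # bs) ! (i - q)) else s ''r'' (int i))"
  proof (cases "q < i")
    case True
    then have "i - q = Suc (i - Suc q)" by simp
    then show ?thesis using True by simp
  qed (auto simp: v_def)
  finally show ?case .
qed simp

text \<open>Multiplies \<open>N\<close> by \<open>M\<close> through repeated addition, in time
  linear in \<open>M\<close>; hence a fixed power of \<open>M\<close> is affordable.\<close>

definition mul :: com where
  "mul = (''Z'' ::= Const 0 ;;
    count ''i'' (Const 0) (V ''M'') (''Z'' ::= Plus (V ''Z'') (V ''N'')) ;;
    ''N'' ::= V ''Z'')"

primrec muls :: "nat \<Rightarrow> com" where
  "muls 0 = Skip"
| "muls (Suc e) = (muls e ;; mul)"

lemma wp_mul:
  assumes "s ''M'' 0 = int M" "s ''N'' 0 = int x"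
  shows "wp mul s (\<lambda>s' t. agree {''i'', ''Z'', ''N''} s' s \<and> s' ''N'' 0 = int (x * M) \<and> t \<le> 3 * M + 4)"
  unfolding mul_def
  apply (rule wp_Seq, rule wp_Assign, rule wp_Seq)
  apply (rule wp_conseq[OF wp_count[where a = 0 and N = M and B = 1 and
      Inv = "\<lambda>i s'. agree {''i'', ''Z''} s' s \<and> s' ''Z'' 0 = int (x * i)"]])
       apply simp
      apply simp
     apply simp
    apply (simp add: agree_def assms)
   apply (rule wp_Assign)
   apply (simp add: agree_def assms algebra_simps)
  apply (rule wp_Assign)
  apply (simp add: agree_def)
  done

lemma wp_muls:
  assumes "s ''M'' 0 = int M" "s ''N'' 0 = int x"
  shows "wp (muls e) s (\<lambda>s' t. agree {''i'', ''Z'', ''N''} s' s \<and> s' ''N'' 0 = int (x * M ^ e) \<and>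
    t \<le> e * (3 * M + 4) + 1)"
proof (induction e)
  case 0
  show ?case unfolding muls.simps by (rule wp_Skip) (use assms in simp)
next
  case (Suc e)
  show ?case
    unfolding muls.simps
    apply (rule wp_Seq)
    apply (rule wp_conseq[OF Suc])
    apply (rule wp_conseq[OF wp_mul[where M = M and x = "x * M ^ e"]])
      apply (simp add: agree_def assms)
     apply simp
    apply (simp add: agree_def algebra_simps)
    done
qed

text \<open>\<open>T = M ^ e\<close> trials and \<open>N = M ^ (e + 2)\<close> coins: the two
  further factors cover the at most \<open>M ^ 2\<close> coins of each trial. The exponent is
  hardwired into the program.\<close>

definition prepare :: "nat \<Rightarrow> com" where
  "prepare e =
    (''M'' ::= Const 1 ;;
     count ''i'' (Const 0) (V ''k'') (''M'' ::= Plus (V ''M'') (V ''M'')) ;;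
     ''M'' ::= Plus (Plus (V ''n'') (V ''m'')) (V ''M'') ;;
     ''N'' ::= Const 1 ;;
     muls e ;;
     ''T'' ::= V ''N'' ;;
     muls 2 ;;
     ''best'' ::= Const (-1) ;;
     ''p'' ::= Const 0 ;;
     ''i'' ::= Const 0)"

lemma wp_prepare:
  fixes e :: nat
  assumes s: "loaded n k I s"
  defines "M \<equiv> magnitude n (length I) k"
  shows "wp (prepare e) s (\<lambda>s' t. loaded n k I s' \<and> s' ''T'' 0 = int (M ^ e) \<and>
    s' ''N'' 0 = int (M ^ (e + 2)) \<and> s' ''best'' 0 = -1 \<and> s' ''p'' 0 = 0 \<and> s' ''i'' 0 = 0 \<and>
    t \<le> 3 * k + (e + 2) * (3 * M + 4) + 11)"
proof -
  let ?X = "{''i'', ''Z'', ''N'', ''M'', ''T'', ''best'', ''p''}"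
  have nmk: "s ''n'' 0 = int n" "s ''m'' 0 = int (length I)" "s ''k'' 0 = int k"
    using s by (auto simp: loaded_def)
  have "wp (prepare e) s (\<lambda>s' t. agree ?X s' s \<and> s' ''T'' 0 = int (M ^ e) \<and>
    s' ''N'' 0 = int (M ^ (e + 2)) \<and> s' ''best'' 0 = -1 \<and> s' ''p'' 0 = 0 \<and> s' ''i'' 0 = 0 \<and>
    t \<le> 3 * k + (e + 2) * (3 * M + 4) + 11)"
    unfolding prepare_def
    apply (rule wp_Seq, rule wp_Assign, rule wp_Seq)
    apply (rule wp_conseq[OF wp_count[where a = 0 and N = k and B = 1 and
      Inv = "\<lambda>i s'. agree {''i'', ''M''} s' s \<and> s' ''M'' 0 = 2 ^ i"]])
         apply simp
        apply simp
       apply simp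
      apply (simp add: agree_def nmk)
     apply (rule wp_Assign)
     apply (simp add: agree_def)
    apply (rule wp_Seq, rule wp_Assign, rule wp_Seq, rule wp_Assign, rule wp_Seq)
    subgoal for s1 t1
      apply (rule wp_conseq[OF wp_muls[where M = M and x = 1]])
        apply (simp add: agree_def nmk M_def magnitude_def)
       apply simp
      apply (rule wp_Seq, rule wp_Assign, rule wp_Seq)
      subgoal for s2 t2
        apply (rule wp_conseq[OF wp_muls[where M = M and x = "M ^ e"]])
          apply (simp add: agree_def nmk M_def magnitude_def)
         apply simp
        apply (rule wp_Seq, rule wp_Assign, rule wp_Seq, rule wp_Assign, rule wp_Assign)
        apply (simp add: agree_def power_add power2_eq_square algebra_simps)
        done
      done
    done
  then show ?thesis
  proof (rule wp_conseq)
    fix s' t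
    assume post: "agree ?X s' s \<and> s' ''T'' 0 = int (M ^ e) \<and>
      s' ''N'' 0 = int (M ^ (e + 2)) \<and> s' ''best'' 0 = -1 \<and> s' ''p'' 0 = 0 \<and> s' ''i'' 0 = 0 \<and>
      t \<le> 3 * k + (e + 2) * (3 * M + 4) + 11"
    then have "loaded n k I s'" using s loaded_agree[of ?X s' s n k I] by simp
    with post show "loaded n k I s' \<and> s' ''T'' 0 = int (M ^ e) \<and>
      s' ''N'' 0 = int (M ^ (e + 2)) \<and> s' ''best'' 0 = -1 \<and> s' ''p'' 0 = 0 \<and> s' ''i'' 0 = 0 \<and>
      t \<le> 3 * k + (e + 2) * (3 * M + 4) + 11" by blast
  qed
qed

lemma concat_nth_uniform:
  assumes "\<And>xs. xs \<in> set xss \<Longrightarrow> length xs = k" "l < length xss" "i < k"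
  shows "l * k + i < length (concat xss) \<and> concat xss ! (l * k + i) = xss ! l ! i"
  using assms
proof (induction xss arbitrary: l)
  case (Cons xs xss)
  then show ?case
    by (cases l) (auto simp: nth_append)
qed simp

lemma loaded_encode:
  assumes "max_kxor n k I"
  shows "loaded n k I (encode n k I)"
proof -
  let ?xss = "map (\<lambda>C. sorted_list_of_set (fst C)) I"
  have len: "length xs = k" if "xs \<in> set ?xss" for xs
  proof -
    obtain l where "l < length I" "xs = sorted_list_of_set (fst (I ! l))"
      using \<open>xs \<in> set ?xss\<close> unfolding in_set_conv_nth by auto
    then show ?thesis using scope(2)[OF assms] by simp
  qed
  have "encode n k I ''scope'' (int (l * k + i)) = int (sorted_list_of_set (fst (I ! l)) ! i)"
    if "l < length I" "i < k" for l i
    using concat_nth_uniform[of ?xss k l i] len that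
    by (simp add: encode_def array_of_def del: of_nat_add of_nat_mult)
  moreover have "encode n k I ''sign'' (int l) = snd (I ! l)" if "l < length I" for l
    using that by (simp add: encode_def array_of_def)
  ultimately show ?thesis
    by (simp add: loaded_def encode_def array_of_def)
qed

section \<open>The assembled algorithm\<close>

definition search :: com where
  "search = count ''t'' (Const 0) (V ''T'') trial"

text \<open>All coins are flipped before the search, so that the rest of the program is deterministic.\<close>

definition program :: "nat \<Rightarrow> com" where
  "program e = (prepare e ;; flips ;; search)"

definition trial_cost :: "nat \<Rightarrow> nat \<Rightarrow> nat \<Rightarrow> nat" where
  "trial_cost n k m = 3 * k * n + 22 * n + 3 * k + 30 + 2 * m * (7 * k + 9)"

context
  fixes n k :: nat and I :: "xor_constraint list"
  assumes inst: "max_kxor n k I"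
begin

lemma wp_search:
  fixes \<rho> :: "nat \<Rightarrow> bool" and T :: nat
  defines "w \<equiv> \<lambda>t. improved n k I (\<lambda>i. \<rho> (t * (n + k + n * k) + i))"
  assumes s: "loaded n k I s" "s ''p'' 0 = 0" "s ''T'' 0 = int T" "s ''best'' 0 = -1"
    and T: "1 \<le> T"
    and r: "\<And>i. i < T * (n + k + n * k) \<Longrightarrow> s ''r'' (int i) = of_bool (\<rho> i)"
  shows "wp search s (\<lambda>s' t. assignment n (output_of s') \<and>
    (\<forall>t<T. \<bar>bias I (w t)\<bar> \<le> \<bar>bias I (output_of s')\<bar>) \<and>
    (odd k \<longrightarrow> 0 \<le> bias I (output_of s')) \<and> t \<le> T * (trial_cost n k (length I) + 2) + 2)"
proof -
  let ?L = "n + k + n * k"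
  let ?X = "{''i'', ''j'', ''l'', ''c'', ''o'', ''B'', ''H'', ''y'', ''U'', ''R'', ''A'', ''p'', ''best'', ''x'', ''t''}"
  define good where "good s' \<longleftrightarrow> assignment n (output_of s') \<and>
      \<bar>bias I (output_of s')\<bar> = s' ''best'' 0 \<and> (odd k \<longrightarrow> bias I (output_of s') = s' ''best'' 0)" for s'
  \<comment> \<open>The initial value -1 lies below every absolute bias, so the first trial is
    always recorded, even if its bias is 0; this makes the output an assignment.\<close>
  let ?Inv = "\<lambda>t s'. agree ?X s' s \<and> s' ''p'' 0 = int (t * ?L) \<and>
    (t = 0 \<and> s' ''best'' 0 = -1 \<or> good s') \<and> (\<forall>t'<t. \<bar>bias I (w t')\<bar> \<le> s' ''best'' 0)"
  have good_put: "good (put ''t'' 0 c s') = good s'" for c s'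
  proof -
    have "output_of (put ''t'' 0 c s') = output_of s'" by (simp add: output_of_def fun_eq_iff)
    then show ?thesis by (simp add: good_def)
  qed
  have step: "wp trial s1 (\<lambda>s' c. s' ''t'' 0 = int t \<and> ?Inv (Suc t) (put ''t'' 0 (int (Suc t)) s') \<and>
      c \<le> trial_cost n k (length I))"
    if t: "t < T" and inv: "?Inv t s1" and st: "s1 ''t'' 0 = int t" for t s1
  proof (rule wp_conseq[OF wp_trial[OF inst, where p = "t * ?L" and \<rho> = \<rho>]])
    show "loaded n k I s1"
      using inv s(1) loaded_agree[of ?X s1 s n k I] by simp
    show "s1 ''p'' 0 = int (t * ?L)" using inv by simp
    fix i assume "i < ?L"
    then have "t * ?L + i < t * ?L + ?L" by simp
    also have "\<dots> = Suc t * ?L" by simp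
    also have "\<dots> \<le> T * ?L" using t by (intro mult_le_mono1) simp
    finally have "t * ?L + i < T * ?L" .
    from r[OF this] show "s1 ''r'' (int (t * ?L + i)) = of_bool (\<rho> (t * ?L + i))"
      using inv by (simp add: agree_def)
  next
    fix s' c
    assume post: "agree {''i'', ''j'', ''l'', ''c'', ''o'', ''B'', ''H'', ''y'', ''U'', ''R'', ''A'', ''p'', ''best'', ''x''} s' s1 \<and>
      s' ''p'' 0 = int (t * ?L + ?L) \<and>
      (if s1 ''best'' 0 < \<bar>bias I (improved n k I (\<lambda>i. \<rho> (t * ?L + i)))\<bar>
       then s' ''best'' 0 = \<bar>bias I (improved n k I (\<lambda>i. \<rho> (t * ?L + i)))\<bar> \<and>
         (\<forall>j\<in>{1..n}. s' ''x'' (int j) =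
           (if bias I (improved n k I (\<lambda>i. \<rho> (t * ?L + i))) < 0
            then - improved n k I (\<lambda>i. \<rho> (t * ?L + i)) j else improved n k I (\<lambda>i. \<rho> (t * ?L + i)) j))
       else s' ''best'' 0 = s1 ''best'' 0 \<and> s' ''x'' = s1 ''x'') \<and>
      c \<le> 3 * k * n + 22 * n + 3 * k + 30 + 2 * length I * (7 * k + 9)"
    let ?b = "bias I (w t)"
    have ag: "agree ?X (put ''t'' 0 (int (Suc t)) s') s"
      using post inv by (auto simp: agree_def)
    have t': "s' ''t'' 0 = int t" using post st by (simp add: agree_def)
    have "good s' \<and> (\<forall>t'<Suc t. \<bar>bias I (w t')\<bar> \<le> s' ''best'' 0)"
    proof (cases "s1 ''best'' 0 < \<bar>?b\<bar>")
      case True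
      then have best: "s' ''best'' 0 = \<bar>?b\<bar>"
        and x: "\<And>j. j \<in> {1..n} \<Longrightarrow> output_of s' j = (if ?b < 0 then - w t j else w t j)"
        using post by (auto simp: w_def output_of_def)
      \<comment> \<open>For odd \<open>k\<close> recording the negated assignment turns a negative
        bias into its absolute value; for even \<open>k\<close> the bias is unchanged, and only its
        absolute value matters.\<close>
      have out: "bias I (output_of s') = (if ?b < 0 then (-1) ^ k * ?b else ?b)"
        using bias_cong[OF inst x] bias_uminus[OF inst, of "w t"] by (simp split: if_splits)
      have "assignment n (w t)" unfolding w_def by (rule assignment_improved[OF inst])
      then have "assignment n (output_of s')" using x by (auto simp: assignment_def)
      moreover have "\<bar>bias I (output_of s')\<bar> = \<bar>?b\<bar>" unfolding out by (simp add: abs_mult power_abs)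
      moreover have "odd k \<Longrightarrow> bias I (output_of s') = \<bar>?b\<bar>" unfolding out by simp
      ultimately have "good s'" by (simp add: good_def best)
      moreover have "\<forall>t'<Suc t. \<bar>bias I (w t')\<bar> \<le> s' ''best'' 0"
        using inv True best by (auto simp: less_Suc_eq)
      ultimately show ?thesis by simp
    next
      case False
      then have eq: "s' ''best'' 0 = s1 ''best'' 0" "s' ''x'' = s1 ''x''"
        using post by (auto simp: w_def)
      have "s1 ''best'' 0 \<noteq> -1" using False by auto
      then have "good s1" using inv by auto
      moreover have "output_of s' = output_of s1" using eq by (simp add: output_of_def fun_eq_iff)
      ultimately have "good s'" using eq by (simp add: good_def)
      then show ?thesis using False inv eq by (auto simp: less_Suc_eq)
    qed
    then show "s' ''t'' 0 = int t \<and> ?Inv (Suc t) (put ''t'' 0 (int (Suc t)) s') \<and>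
        c \<le> trial_cost n k (length I)"
      using ag t' post by (simp add: good_put trial_cost_def algebra_simps)
  qed
  show ?thesis
    unfolding search_def
    apply (rule wp_conseq[OF wp_count[where a = 0 and N = T and B = "trial_cost n k (length I)" and Inv = ?Inv]])
         apply simp
        apply simp
       apply (simp add: s)
      apply (simp add: agree_def s)
     apply (rule step; assumption)
    apply (use T in \<open>auto simp: good_def\<close>)
    done
qed

text \<open>Given the coins, the final store and the time are functions of the coin list, so every
  probability about the program becomes an average over lists.\<close>

lemma exec_program:
  fixes e :: nat
  defines "M \<equiv> magnitude n (length I) k"
  defines "w \<equiv> \<lambda>bs t. improved n k I (\<lambda>i. bs ! (t * (n + k + n * k) + i))"
  shows "n + k + n * k \<le> M ^ 2" (is "?L \<le> _")
    and "\<exists>S \<tau>. exec (program e) (encode n k I) = map_spmf (\<lambda>bs. (S bs, \<tau> bs)) (coins (M ^ (e + 2))) \<and>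
      (\<forall>bs. length bs = M ^ (e + 2) \<longrightarrow>
        assignment n (output_of (S bs)) \<and>
        (\<forall>t<M ^ e. \<bar>bias I (w bs t)\<bar> \<le> \<bar>bias I (output_of (S bs))\<bar>) \<and>
        (odd k \<longrightarrow> 0 \<le> bias I (output_of (S bs))) \<and>
        \<tau> bs \<le> (7 * e + 140) * M ^ (e + 2))"
proof -
  have le: "n \<le> M" "k \<le> M" "length I \<le> M" "1 \<le> M"
  proof -
    have "k < 2 ^ k" by (rule less_exp)
    then show "k \<le> M" "1 \<le> M" unfolding M_def magnitude_def by linarith+
  qed (simp_all add: M_def magnitude_def)
  show L: "?L \<le> M ^ 2"
  proof -
    have k: "k \<le> 2 ^ k" using less_exp[of k] by simp
    have "n + k + n * k \<le> n * 2 ^ k + 2 ^ k * 2 ^ k + n * 2 ^ k"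
      by (intro add_mono mult_le_mono) (use k in \<open>auto intro: order_trans[OF k]\<close>)
    also have "\<dots> \<le> (n + 2 ^ k) ^ 2" by (simp add: power2_eq_square algebra_simps)
    also have "\<dots> \<le> M ^ 2" by (intro power_mono) (auto simp: M_def magnitude_def)
    finally show ?thesis .
  qed
  obtain s1 t1 where 1: "exec (prepare e) (encode n k I) = return_spmf (s1, t1)"
    and s1: "loaded n k I s1" "s1 ''T'' 0 = int (M ^ e)" "s1 ''N'' 0 = int (M ^ (e + 2))"
      "s1 ''best'' 0 = -1" "s1 ''p'' 0 = 0" "s1 ''i'' 0 = 0"
    and t1: "t1 \<le> 3 * k + (e + 2) * (3 * M + 4) + 11"
    using wp_prepare[OF loaded_encode[OF inst], of e] unfolding wp_def M_def by blast
  let ?P = "\<lambda>bs s' t. assignment n (output_of s') \<and>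
    (\<forall>t<M ^ e. \<bar>bias I (w bs t)\<bar> \<le> \<bar>bias I (output_of s')\<bar>) \<and>
    (odd k \<longrightarrow> 0 \<le> bias I (output_of s')) \<and> t \<le> M ^ e * (trial_cost n k (length I) + 2) + 2"
  have "\<exists>s' t. exec search (fill s1 bs) = return_spmf (s', t) \<and> ?P bs s' t"
    if "length bs = M ^ (e + 2)" for bs
    unfolding wp_def[symmetric] w_def
  proof (rule wp_search)
    have ag: "agree {''i'', ''r''} (fill s1 bs) s1" by (rule agree_fill)
    show "loaded n k I (fill s1 bs)" using loaded_agree[OF ag, of n k I] s1(1) by simp
    show "fill s1 bs ''p'' 0 = 0" "fill s1 bs ''T'' 0 = int (M ^ e)" "fill s1 bs ''best'' 0 = -1"
      using ag s1 by (simp_all add: agree_def)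
    show "1 \<le> M ^ e" using le(4) by simp
    fix i assume "i < M ^ e * ?L"
    also have "\<dots> \<le> M ^ e * M ^ 2" using L by simp
    also have "\<dots> = length bs" unfolding that power_add ..
    finally show "fill s1 bs ''r'' (int i) = of_bool (bs ! i)"
      using fill_r[of s1 0 bs i] s1(6) by simp
  qed
  \<comment> \<open>Choice turns the outcome for each coin list into functions \<open>S\<close> and
    \<open>\<tau>\<close>; on lists of other lengths their values are arbitrary.\<close>
  then have "\<forall>bs. \<exists>r. length bs = M ^ (e + 2) \<longrightarrow>
      exec search (fill s1 bs) = return_spmf r \<and> ?P bs (fst r) (snd r)"
    by (metis (lifting) fst_conv snd_conv)
  from choice[OF this] obtain f where f: "\<forall>bs. length bs = M ^ (e + 2) \<longrightarrow>
      exec search (fill s1 bs) = return_spmf (f bs) \<and> ?P bs (fst (f bs)) (snd (f bs))" ..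
  define S where "S bs = fst (f bs)" for bs
  define \<tau> where "\<tau> bs = snd (f bs)" for bs
  have S: "exec search (fill s1 bs) = return_spmf (S bs, \<tau> bs)" "?P bs (S bs) (\<tau> bs)"
    if "length bs = M ^ (e + 2)" for bs
    using f[rule_format, OF that] unfolding S_def \<tau>_def by simp_all
  let ?\<tau> = "\<lambda>bs. t1 + (3 * M ^ (e + 2) + 1 + \<tau> bs)"
  have fl: "exec flips s1 = map_spmf (\<lambda>bs. (fill s1 bs, 3 * M ^ (e + 2) + 1)) (coins (M ^ (e + 2)))"
    by (rule exec_flips) (use s1 in simp)
  have "exec (program e) (encode n k I) =
      bind_spmf (coins (M ^ (e + 2))) (\<lambda>bs. bind_spmf (exec search (fill s1 bs))
        (\<lambda>(s2, t2). return_spmf (s2, t1 + (3 * M ^ (e + 2) + 1 + t2))))"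
    by (simp only: program_def exec.simps(4) 1 fl return_bind_spmf bind_map_spmf bind_spmf_assoc
        o_def case_prod_unfold fst_conv snd_conv)
  also have "\<dots> = bind_spmf (coins (M ^ (e + 2))) (\<lambda>bs. return_spmf (S bs, ?\<tau> bs))"
    by (rule bind_spmf_cong) (simp_all add: S length_coins)
  finally have ex: "exec (program e) (encode n k I) = map_spmf (\<lambda>bs. (S bs, ?\<tau> bs)) (coins (M ^ (e + 2)))"
    by (simp add: map_spmf_conv_bind_spmf)
  have time: "?\<tau> bs \<le> (7 * e + 140) * M ^ (e + 2)" if "length bs = M ^ (e + 2)" for bs
  proof -
    have MM: "M \<le> M ^ 2" "1 \<le> M ^ 2" using le(4) by (auto simp: power2_eq_square)
    have "trial_cost n k (length I) \<le> 3 * M * M + 22 * M + 3 * M + 30 + 2 * M * (7 * M + 9)"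
      unfolding trial_cost_def by (intro add_mono mult_le_mono le order_refl)
    also have "\<dots> = 17 * M ^ 2 + 43 * M + 30" by (simp add: power2_eq_square algebra_simps)
    also have "\<dots> \<le> 90 * M ^ 2" using MM by linarith
    finally have "M ^ e * (trial_cost n k (length I) + 2) \<le> M ^ e * (92 * M ^ 2)"
      using MM by (intro mult_le_mono) auto
    also have "\<dots> = 92 * M ^ (e + 2)" by (simp add: power_add power2_eq_square)
    finally have a: "\<tau> bs \<le> 92 * M ^ (e + 2) + 2" using S(2)[OF that] by linarith
    have "M ^ 1 \<le> M ^ (e + 2)" by (rule power_increasing) (use le(4) in auto)
    then have b: "M \<le> M ^ (e + 2)" by simp
    have "t1 \<le> 3 * M + (e + 2) * (7 * M) + 11 * M"
    proof -
      have "(e + 2) * (3 * M + 4) \<le> (e + 2) * (7 * M)" using le(4) by (intro mult_le_mono) auto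
      then show ?thesis using t1 le by linarith
    qed
    also have "\<dots> = (7 * e + 28) * M" by (simp add: algebra_simps)
    also have "\<dots> \<le> (7 * e + 28) * M ^ (e + 2)" using b by (rule mult_le_mono2)
    finally have "?\<tau> bs \<le> (7 * e + 28) * M ^ (e + 2) + 95 * M ^ (e + 2) + 3" using a by linarith
    also have "\<dots> \<le> (7 * e + 28) * M ^ (e + 2) + 112 * M ^ (e + 2)" using b le(4) by linarith
    also have "\<dots> = (7 * e + 140) * M ^ (e + 2)" by (simp add: algebra_simps)
    finally show ?thesis .
  qed
  show "\<exists>S \<tau>. exec (program e) (encode n k I) = map_spmf (\<lambda>bs. (S bs, \<tau> bs)) (coins (M ^ (e + 2))) \<and>
      (\<forall>bs. length bs = M ^ (e + 2) \<longrightarrow>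
        assignment n (output_of (S bs)) \<and>
        (\<forall>t<M ^ e. \<bar>bias I (w bs t)\<bar> \<le> \<bar>bias I (output_of (S bs))\<bar>) \<and>
        (odd k \<longrightarrow> 0 \<le> bias I (output_of (S bs))) \<and>
        \<tau> bs \<le> (7 * e + 140) * M ^ (e + 2))"
  proof (rule exI[of _ S], rule exI[of _ ?\<tau>], rule conjI[OF ex], intro allI impI)
    fix bs :: "bool list" assume bs: "length bs = M ^ (e + 2)"
    show "assignment n (output_of (S bs)) \<and>
        (\<forall>t<M ^ e. \<bar>bias I (w bs t)\<bar> \<le> \<bar>bias I (output_of (S bs))\<bar>) \<and>
        (odd k \<longrightarrow> 0 \<le> bias I (output_of (S bs))) \<and>
        ?\<tau> bs \<le> (7 * e + 140) * M ^ (e + 2)"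
      using S(2)[OF bs] by (elim conjE) (intro conjI time[OF bs]; assumption)
  qed
qed

text \<open>\<open>Q\<close> abstracts from the two targets, so one program serves both: for odd
  \<open>k\<close> the output has value at least \<open>1 / 2\<close>, which removes the absolute
  value. The output is at least as biased as every trial, so one successful trial suffices.\<close>

lemma prob_program_ge:
  fixes a D :: nat
  assumes D: "\<forall>i\<in>{1..n}. var_degree I i \<le> D"
    and Q: "\<And>x. assignment n x \<Longrightarrow> advantage k / sqrt D \<le> \<bar>val I x - 1 / 2\<bar> \<Longrightarrow>
      (odd k \<Longrightarrow> 1 / 2 \<le> val I x) \<Longrightarrow> Q x"
  shows "1 - 1 / real (n + length I) ^ a \<le> prob_finds (program (a + 9)) n k I Q"
proof -
  define M where "M = magnitude n (length I) k"
  let ?L = "n + k + n * k"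
  let ?w = "\<lambda>bs t. improved n k I (\<lambda>i. bs ! (t * ?L + i))"
  let ?N = "M ^ (a + 9 + 2)"
  have m: "0 < real (length I)" using I_nonempty[OF inst] by simp
  obtain S \<tau> where ex: "exec (program (a + 9)) (encode n k I) = map_spmf (\<lambda>bs. (S bs, \<tau> bs)) (coins ?N)"
    and S: "\<forall>bs. length bs = ?N \<longrightarrow> assignment n (output_of (S bs)) \<and>
        (\<forall>t<M ^ (a + 9). \<bar>bias I (?w bs t)\<bar> \<le> \<bar>bias I (output_of (S bs))\<bar>) \<and>
        (odd k \<longrightarrow> 0 \<le> bias I (output_of (S bs))) \<and> \<tau> bs \<le> (7 * (a + 9) + 140) * ?N"
    using exec_program(2)[of "a + 9"] unfolding M_def[symmetric] by (elim exE conjE) (rule that)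
  have "M ^ (a + 9) * ?L \<le> M ^ (a + 9) * M ^ 2"
    using exec_program(1) by (intro mult_le_mono2) (simp add: M_def)
  \<comment> \<open>The trials are packed densely; \<open>E\<close> counts the coins left over at
    the end of the string.\<close>
  then obtain E where E: "?N = M ^ (a + 9) * ?L + E"
    unfolding power_add by (metis le_iff_add)
  have "1 - 1 / real (n + length I) ^ a \<le> avg ?N (\<lambda>bs. of_bool (\<exists>t<M ^ (a + 9).
      advantage k / sqrt D \<le> \<bar>val I (?w bs t) - 1 / 2\<bar>))"
    unfolding E unfolding M_def by (rule prob_some_trial_ge[OF inst D])
  also have "\<dots> \<le> avg ?N (\<lambda>bs. of_bool (assignment n (output_of (S bs)) \<and> Q (output_of (S bs))))"
  proof (rule avg_mono)
    fix bs :: "bool list" assume bs: "length bs = ?N"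
    have S_at: "assignment n (output_of (S bs))"
      "\<And>t. t < M ^ (a + 9) \<Longrightarrow> \<bar>bias I (?w bs t)\<bar> \<le> \<bar>bias I (output_of (S bs))\<bar>"
      "odd k \<Longrightarrow> 0 \<le> bias I (output_of (S bs))"
      using S[rule_format, OF bs] by simp_all
    have "Q (output_of (S bs))"
      if t: "t < M ^ (a + 9)" and adv: "advantage k / sqrt D \<le> \<bar>val I (?w bs t) - 1 / 2\<bar>" for t
    proof (rule Q)
      show ass: "assignment n (output_of (S bs))" by (rule S_at(1))
      have "\<bar>real_of_int (bias I (?w bs t))\<bar> \<le> \<bar>real_of_int (bias I (output_of (S bs)))\<bar>"
        using S_at(2)[OF t] by linarith
      then have "\<bar>val I (?w bs t) - 1 / 2\<bar> \<le> \<bar>val I (output_of (S bs)) - 1 / 2\<bar>"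
        unfolding bias_eq[OF inst ass] bias_eq[OF inst assignment_improved[OF inst]] abs_mult
        using m by simp
      then show "advantage k / sqrt D \<le> \<bar>val I (output_of (S bs)) - 1 / 2\<bar>" using adv by linarith
      assume "odd k"
      then have "0 \<le> real_of_int (bias I (output_of (S bs)))" using S_at(3) by simp
      then show "1 / 2 \<le> val I (output_of (S bs))"
        unfolding bias_eq[OF inst ass] using m by (simp add: zero_le_mult_iff)
    qed
    then show "of_bool (\<exists>t<M ^ (a + 9). advantage k / sqrt D \<le> \<bar>val I (?w bs t) - 1 / 2\<bar>)
        \<le> (of_bool (assignment n (output_of (S bs)) \<and> Q (output_of (S bs))) :: real)"
      using S_at(1) by auto
  qed
  also have "\<dots> = prob_finds (program (a + 9)) n k I Q"
    unfolding prob_finds_def ex measure_coins[symmetric] measure_map_spmf vimage_def by simp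
  finally show ?thesis .
qed

end

text \<open>As \<open>2 ^ k\<close> is at most \<open>exp k\<close>, the magnitude is at most the
  base of the admissible time bound.\<close>

lemma poly_time_program: "poly_time (program e)"
  unfolding poly_time_def
proof (intro exI[of _ "real (7 * e + 140)"] exI[of _ "e + 2"] allI impI)
  fix n k :: nat and I :: "xor_constraint list"
  assume inst: "max_kxor n k I"
  define M where "M = magnitude n (length I) k"
  obtain S \<tau> where ex: "exec (program e) (encode n k I) = map_spmf (\<lambda>bs. (S bs, \<tau> bs)) (coins (M ^ (e + 2)))"
    and "\<forall>bs. length bs = M ^ (e + 2) \<longrightarrow>
        assignment n (output_of (S bs)) \<and>
        (\<forall>t<M ^ e. \<bar>bias I (improved n k I (\<lambda>i. bs ! (t * (n + k + n * k) + i)))\<bar>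
          \<le> \<bar>bias I (output_of (S bs))\<bar>) \<and>
        (odd k \<longrightarrow> 0 \<le> bias I (output_of (S bs))) \<and> \<tau> bs \<le> (7 * e + 140) * M ^ (e + 2)"
    using exec_program(2)[OF inst, of e] unfolding M_def[symmetric] by (elim exE conjE) (rule that)
  then have time: "\<tau> bs \<le> (7 * e + 140) * M ^ (e + 2)" if "length bs = M ^ (e + 2)" for bs
    using that by simp
  have "(2::real) ^ k \<le> exp 1 ^ k" by (rule power_mono) (use exp_ge_add_one_self[of 1] in auto)
  then have M: "real M \<le> real (length I) + real n + exp (real k)"
    by (simp add: M_def magnitude_def exp_of_nat_mult[symmetric])
  have "real t \<le> real (7 * e + 140) * (real (length I) + real n + exp (real k)) ^ (e + 2)"
    if "(s, t) \<in> set_spmf (exec (program e) (encode n k I))" for s t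
  proof -
    have "(s, t) \<in> (\<lambda>bs. (S bs, \<tau> bs)) ` set_spmf (coins (M ^ (e + 2)))"
      using that unfolding ex set_map_spmf .
    then obtain bs where "(s, t) = (S bs, \<tau> bs)" and "bs \<in> set_spmf (coins (M ^ (e + 2)))"
      by (rule imageE)
    then have bs: "bs \<in> set_spmf (coins (M ^ (e + 2)))" "t = \<tau> bs" by simp_all
    have "real t \<le> real ((7 * e + 140) * M ^ (e + 2))"
      unfolding bs(2) of_nat_le_iff by (rule time[OF length_coins[OF bs(1)]])
    also have "\<dots> = real (7 * e + 140) * real M ^ (e + 2)" by (simp only: of_nat_mult of_nat_power)
    also have "\<dots> \<le> real (7 * e + 140) * (real (length I) + real n + exp (real k)) ^ (e + 2)"
      by (intro mult_left_mono power_mono M) auto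
    finally show ?thesis .
  qed
  then show "lossless_spmf (exec (program e) (encode n k I)) \<and>
    (\<forall>(s, t)\<in>set_spmf (exec (program e) (encode n k I)).
      real t \<le> real (7 * e + 140) * (real (length I) + real n + exp (real k)) ^ (e + 2))"
    by (auto simp: ex)
qed

theorem theorem1p1:
  "\<exists>c :: nat \<Rightarrow> real.
     (\<exists>A :: real. \<forall>k\<ge>1. exp (- A * real k) \<le> c k) \<and>
     (\<forall>a :: nat. \<exists>P. poly_time P \<and>
        (\<forall>n k I D. max_kxor n k I \<and> (\<forall>i\<in>{1..n}. var_degree I i \<le> D) \<longrightarrow>
           prob_finds P n k I (\<lambda>x. \<bar>val I x - 1/2\<bar> \<ge> c k / sqrt (real D))
             \<ge> 1 - 1 / real (n + length I) ^ a)) \<and>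
     (\<forall>a :: nat. \<exists>P. poly_time P \<and>
        (\<forall>n k I D. max_kxor n k I \<and> odd k \<and> (\<forall>i\<in>{1..n}. var_degree I i \<le> D) \<longrightarrow>
           prob_finds P n k I (\<lambda>x. val I x \<ge> 1/2 + c k / sqrt (real D))
             \<ge> 1 - 1 / real (n + length I) ^ a))"
proof (intro exI[of _ advantage] conjI allI exI[of _ "2 * ln 24"] impI)
  fix k :: nat assume "1 \<le> k"
  \<comment> \<open>The witness \<open>2 * ln 24\<close> comes from \<open>k + 1 <= 2 * k\<close>:
    doubling the exponent absorbs the constant factor 24 of \<open>advantage\<close>.\<close>
  have "exp (- (2 * ln 24) * real k) = 1 / exp (ln 24 * real (2 * k))"
    by (simp add: exp_minus inverse_eq_divide mult.commute mult.left_commute)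
  also have "exp (ln 24 * real (2 * k)) = (24::real) ^ (2 * k)"
    by (simp only: mult.commute[of "ln 24"] exp_of_nat_mult) simp
  also have "1 / (24::real) ^ (2 * k) \<le> 1 / 24 ^ (k + 1)"
    using \<open>1 \<le> k\<close> by (intro divide_left_mono power_increasing) auto
  finally show "exp (- (2 * ln 24) * real k) \<le> advantage k" by (simp only: advantage_def)
next
  fix a :: nat
  show "\<exists>P. poly_time P \<and>
        (\<forall>n k I D. max_kxor n k I \<and> (\<forall>i\<in>{1..n}. var_degree I i \<le> D) \<longrightarrow>
           prob_finds P n k I (\<lambda>x. \<bar>val I x - 1/2\<bar> \<ge> advantage k / sqrt (real D))
             \<ge> 1 - 1 / real (n + length I) ^ a)"
    by (intro exI[of _ "program (a + 9)"] conjI poly_time_program allI impI prob_program_ge) auto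
  show "\<exists>P. poly_time P \<and>
        (\<forall>n k I D. max_kxor n k I \<and> odd k \<and> (\<forall>i\<in>{1..n}. var_degree I i \<le> D) \<longrightarrow>
           prob_finds P n k I (\<lambda>x. val I x \<ge> 1/2 + advantage k / sqrt (real D))
             \<ge> 1 - 1 / real (n + length I) ^ a)"
    by (intro exI[of _ "program (a + 9)"] conjI poly_time_program allI impI prob_program_ge) auto
qed

end
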